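(* One has $$3\leqslant \Gamma_2\leqslant\sqrt{1+(2\mathrm e-1)^2}<4.55,$$ where $\mathrm e$ is the base of the natural logarithm.
   Context: All Banach algebras are complex and unital, and the unit has norm one. For $a$ in a unital Banach algebra $\mathcal A$, the algebraic numerical range is $V(a,\mathcal A)=\{\varphi(a):\varphi\in\mathcal A',\ \|\varphi\|=1=\varphi(1)\}$, where $\mathcal A'$ is the dual space. The spectral constant of $a$ is $$\Psi(a,\mathcal A)=\sup\left\{\frac{\|p(a)\|}{\sup_{z\in V(a,\mathcal A)}|p(z)|}:\ p\in\mathbb C[z],\ \sup_{z\in V(a,\mathcal A)}|p(z)|>0\right\}.$$ The algebraic degree of an element is the degree of its minimal polynomial, and $$\Gamma_2=\sup\{\Psi(a,\mathcal A):\ \mathcal A\text{ a unital Banach algebra},\ a\in\mathcal A\text{ of algebraic degree at most }2\}.$$ *)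

theory Defs
  imports
    "HOL-Analysis.Analysis"
    "HOL-Algebra.Module"
    "HOL-Computational_Algebra.Polynomial"
begin

text \<open>
  Banach algebras are carrier-based structures, so that a supremum over all of them can be formed
  inside the logic. A structure is a module record over the complex field, which also
  carries a multiplication and a unit, extended by a norm.
\<close>

definition complex_ring :: "complex ring" where
  "complex_ring = \<lparr>carrier = UNIV, mult = (*), one = 1, zero = 0, add = (+)\<rparr>"

lemma cring_complex_ring: "cring complex_ring"
proof (rule cringI)
  show "abelian_group complex_ring"
    by (rule abelian_groupI)
       (auto simp: complex_ring_def add.assoc add.commute intro: exI[of _ "- x" for x])
  show "Group.comm_monoid complex_ring"
    by (rule comm_monoidI) (auto simp: complex_ring_def)
qed (simp add: complex_ring_def algebra_simps)

record 'a calgebra = "(complex, 'a) module" +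
  nrm :: "'a \<Rightarrow> real"

text \<open>
  The distance is set to 0 off the carrier only because \<^locale>\<open>Metric_space\<close> asks for
  nonnegativity and symmetry on the whole type.
\<close>

definition nrm_dist :: "'a calgebra \<Rightarrow> 'a \<Rightarrow> 'a \<Rightarrow> real" where
  "nrm_dist A x y = (if x \<in> carrier A \<and> y \<in> carrier A then nrm A (x \<ominus>\<^bsub>A\<^esub> y) else 0)"

locale unital_banach_algebra = module complex_ring A + ring A
  for A :: "'a calgebra" (structure) +
  assumes smult_mult_left:
      "\<lbrakk>x \<in> carrier A; y \<in> carrier A\<rbrakk> \<Longrightarrow> (c \<odot> x) \<otimes> y = c \<odot> (x \<otimes> y)"
    and smult_mult_right:
      "\<lbrakk>x \<in> carrier A; y \<in> carrier A\<rbrakk> \<Longrightarrow> x \<otimes> (c \<odot> y) = c \<odot> (x \<otimes> y)"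
    and nrm_nonneg: "x \<in> carrier A \<Longrightarrow> 0 \<le> nrm A x"
    and nrm_eq_0_iff: "x \<in> carrier A \<Longrightarrow> nrm A x = 0 \<longleftrightarrow> x = \<zero>"
    and nrm_triangle:
      "\<lbrakk>x \<in> carrier A; y \<in> carrier A\<rbrakk> \<Longrightarrow> nrm A (x \<oplus> y) \<le> nrm A x + nrm A y"
    and nrm_smult: "x \<in> carrier A \<Longrightarrow> nrm A (c \<odot> x) = cmod c * nrm A x"
    and nrm_mult:
      "\<lbrakk>x \<in> carrier A; y \<in> carrier A\<rbrakk> \<Longrightarrow> nrm A (x \<otimes> y) \<le> nrm A x * nrm A y"
    and nrm_one: "nrm A \<one> = 1"
    and complete: "Metric_space.mcomplete (carrier A) (nrm_dist A)"
begin

lemma nrm_minus_commute: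
  assumes "x \<in> carrier A" "y \<in> carrier A"
  shows "nrm A (x \<ominus> y) = nrm A (y \<ominus> x)"
proof -
  have "- 1 \<in> carrier complex_ring" "1 \<in> carrier complex_ring" "0 \<in> carrier complex_ring"
    by (auto simp: complex_ring_def)
  note cs = this
  let ?d = "x \<ominus> y"
  have d: "?d \<in> carrier A" using assms by simp
  have "(- 1) \<odot> ?d \<oplus> ?d = (- 1) \<odot> ?d \<oplus> 1 \<odot> ?d"
    using smult_one[OF d] by (simp add: complex_ring_def)
  also have "\<dots> = 0 \<odot> ?d"
    using smult_l_distr[OF cs(1,2) d] by (simp add: complex_ring_def)
  also have "\<dots> = \<zero>"
    using smult_l_null[OF d] by (simp add: complex_ring_def)
  finally have "(- 1) \<odot> ?d = \<ominus> ?d"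
    using M.minus_equality[OF _ d smult_closed[OF cs(1) d]] by simp
  also have "\<dots> = y \<ominus> x"
    using assms by (simp add: minus_eq minus_add a_comm)
  finally show ?thesis
    using nrm_smult[OF d, of "- 1"] by simp
qed

sublocale nrm_metric: Metric_space "carrier A" "nrm_dist A"
proof
  show "0 \<le> nrm_dist A x y" for x y
    by (simp add: nrm_dist_def nrm_nonneg)
  show "nrm_dist A x y = nrm_dist A y x" for x y
    by (auto simp: nrm_dist_def nrm_minus_commute)
  show "nrm_dist A x y = 0 \<longleftrightarrow> x = y" if "x \<in> carrier A" "y \<in> carrier A" for x y
  proof -
    have "x \<ominus> y = \<zero> \<longleftrightarrow> x = y"
      using that M.minus_equality[of x "\<ominus> y"] by (auto simp: minus_eq r_neg)
    then show ?thesis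
      using that by (simp add: nrm_dist_def nrm_eq_0_iff)
  qed
  show "nrm_dist A x z \<le> nrm_dist A x y + nrm_dist A y z"
    if "x \<in> carrier A" "y \<in> carrier A" "z \<in> carrier A" for x y z
  proof -
    have "x \<ominus> z = (x \<ominus> y) \<oplus> (y \<ominus> z)"
      using that by (simp add: minus_eq a_assoc r_neg1 r_neg2)
    then show ?thesis
      using that nrm_triangle[of "x \<ominus> y" "y \<ominus> z"] by (simp add: nrm_dist_def)
  qed
qed

end

text \<open>
  Functionals are total functions on the type; only their values on the carrier matter.
\<close>

definition dual :: "'a calgebra \<Rightarrow> ('a \<Rightarrow> complex) set" where
  "dual A = {\<phi>.
     (\<forall>x\<in>carrier A. \<forall>y\<in>carrier A. \<phi> (x \<oplus>\<^bsub>A\<^esub> y) = \<phi> x + \<phi> y) \<and>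
     (\<forall>c. \<forall>x\<in>carrier A. \<phi> (c \<odot>\<^bsub>A\<^esub> x) = c * \<phi> x) \<and>
     (\<exists>K. \<forall>x\<in>carrier A. cmod (\<phi> x) \<le> K * nrm A x)}"

definition dual_norm :: "'a calgebra \<Rightarrow> ('a \<Rightarrow> complex) \<Rightarrow> real" where
  "dual_norm A \<phi> = Sup {cmod (\<phi> x) | x. x \<in> carrier A \<and> nrm A x \<le> 1}"

definition numerical_range :: "'a \<Rightarrow> 'a calgebra \<Rightarrow> complex set" where
  "numerical_range a A = {\<phi> a | \<phi>. \<phi> \<in> dual A \<and> dual_norm A \<phi> = 1 \<and> \<phi> \<one>\<^bsub>A\<^esub> = 1}"

definition alg_eval :: "'a calgebra \<Rightarrow> complex poly \<Rightarrow> 'a \<Rightarrow> 'a" where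
  "alg_eval A p a =
     (\<Oplus>\<^bsub>A\<^esub> i \<in> {..degree p}. coeff p i \<odot>\<^bsub>A\<^esub> (a [^]\<^bsub>A\<^esub> i))"

definition sup_on :: "complex set \<Rightarrow> complex poly \<Rightarrow> ereal" where
  "sup_on V p = (SUP z\<in>V. ereal (cmod (poly p z)))"

definition spectral_const :: "'a \<Rightarrow> 'a calgebra \<Rightarrow> ereal" where
  "spectral_const a A =
     Sup {ereal (nrm A (alg_eval A p a)) / sup_on (numerical_range a A) p | p.
          sup_on (numerical_range a A) p > 0}"

definition algebraic_elem :: "'a calgebra \<Rightarrow> 'a \<Rightarrow> bool" where
  "algebraic_elem A a \<longleftrightarrow> (\<exists>p. p \<noteq> 0 \<and> alg_eval A p a = \<zero>\<^bsub>A\<^esub>)"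

definition minimal_poly :: "'a calgebra \<Rightarrow> 'a \<Rightarrow> complex poly" where
  "minimal_poly A a = (THE p. lead_coeff p = 1 \<and> alg_eval A p a = \<zero>\<^bsub>A\<^esub> \<and>
     (\<forall>q. q \<noteq> 0 \<and> alg_eval A q a = \<zero>\<^bsub>A\<^esub> \<longrightarrow> degree p \<le> degree q))"

definition algebraic_degree :: "'a calgebra \<Rightarrow> 'a \<Rightarrow> nat" where
  "algebraic_degree A a = degree (minimal_poly A a)"

text \<open>
  The supremum over all Banach algebras is relative to a universe: the type \<^typ>\<open>'a\<close> in which the
  carriers live. Any injection of one type into another transports structures along it, so
  enlarging the universe never loses an algebra. A type with no injection from
  \<^typ>\<open>complex\<close> contains no Banach algebra, because the multiples of the unit are
  pairwise different.
\<close>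

definition Gamma2 :: "'a itself \<Rightarrow> ereal" where
  "Gamma2 _ = Sup {spectral_const a A | (A :: 'a calgebra) a.
     unital_banach_algebra A \<and> a \<in> carrier A \<and>
     algebraic_elem A a \<and> algebraic_degree A a \<le> 2}"

end

theory Submission
  imports Defs "HOL-Complex_Analysis.Complex_Analysis"
begin

text \<open>
  Upper bound. Write \<open>a = c + b\<close> with \<open>b\<^sup>2 = \<delta>\<^sup>2\<close> and split \<open>p (c + z) = E (z\<^sup>2) + z Q (z\<^sup>2)\<close>, so that
  \<open>p a = E (\<delta>\<^sup>2) + Q (\<delta>\<^sup>2) b\<close>. Let \<open>K = 2 e - 1\<close> and \<open>r = \<parallel>b\<parallel> / K\<close>. If \<open>r > \<bar>\<delta>\<bar>\<close>, then the closure of the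
  numerical range \<open>V\<close> of \<open>b\<close> contains the disc of radius \<open>r\<close> about \<open>0\<close>: otherwise \<open>V\<close> lies in a half plane
  \<open>Re (u v) < r\<close> with \<open>\<bar>u\<bar> = 1\<close>, hence \<open>\<parallel>exp (u b / r)\<parallel> \<le> e\<close>, and since
  \<open>exp (z b) = cosh (z \<delta>) + sinh (z \<delta>) / \<delta> b\<close> this bounds \<open>\<parallel>b\<parallel>\<close> strictly below \<open>K r\<close>. The maximum principle
  now gives \<open>\<bar>E (\<delta>\<^sup>2)\<bar>\<^sup>2 + r\<^sup>2 \<bar>Q (\<delta>\<^sup>2)\<bar>\<^sup>2 \<le> M\<^sup>2\<close> when \<open>\<bar>p\<bar> \<le> M\<close> on \<open>c + V\<close>. If \<open>r \<le> \<bar>\<delta>\<bar>\<close>, the same holds because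
  the eigenvalues \<open>\<plusminus> \<delta>\<close> lie in the closure of \<open>V\<close>. In both cases Cauchy--Schwarz yields
  \<open>\<parallel>p a\<parallel> \<le> sqrt (1 + K\<^sup>2) M\<close>.

  Lower bound. In \<open>\<ell>\<^sup>1({1, e})\<close> with an idempotent \<open>e\<close>, \<open>\<parallel>p e\<parallel> = \<bar>p 0\<bar> + \<bar>p 1 - p 0\<bar>\<close>, and \<open>V e\<close> lies in the
  closed unit disc, with the eigenvalue \<open>0\<close> at its centre and \<open>1\<close> on its boundary. The Blaschke factor
  \<open>(z - s) / (1 - s z)\<close> has \<open>p 0 = - s\<close> and \<open>p 1 = 1\<close>; let \<open>s \<rightarrow> 1\<close>.
\<close>

subsection \<open>Hyperbolic functions and polynomials bounded on a disc\<close>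

text \<open>Taylor expansion to degree 6, where the terms sum to \<open>1957/720\<close>. In the
  Lagrange remainder the crude bound \<open>exp 1 \<le> 3\<close> is enough.\<close>

lemma exp_one_bounds: "(2718/1000::real) < exp 1" "exp 1 < (2719/1000::real)"
proof -
  obtain t :: real where t: "\<bar>t\<bar> \<le> \<bar>1\<bar>"
    and e: "exp 1 = (\<Sum>m<7. 1 ^ m / fact m) + exp t / fact 7 * 1 ^ 7"
    using Maclaurin_exp_le[of 1 7] by blast
  have s: "(\<Sum>m<7. 1 ^ m / fact m) = (1957/720 :: real)"
    by (simp add: eval_nat_numeral)
  have "exp t \<le> exp 1" using t by simp
  then have "exp t \<le> 3" using exp_le by linarith
  moreover have "fact 7 = (5040::real)" by (simp add: eval_nat_numeral)
  ultimately have q: "exp t / fact 7 \<le> 3 / 5040" "0 < exp t / fact 7" by simp_all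
  have "exp 1 = 1957 / 720 + exp t / fact 7"
    using e unfolding s unfolding power_one mult_1_right .
  then show "(2718/1000::real) < exp 1" "exp 1 < (2719/1000::real)"
    using q by linarith+
qed

text \<open>Taylor's formula of order 4 for the cosine at \<open>2 * y\<close>, whose remainder is
  at most \<open>(2 * y) ^ 4 / 24\<close>, turned into a bound for the sine by the double angle
  formula.\<close>

lemma sin_squared_ge: "y\<^sup>2 - y ^ 4 / 3 \<le> (sin (y::real))\<^sup>2"
proof -
  obtain t where t: "cos (2 * y) = (\<Sum>m<4. cos_coeff m * (2 * y) ^ m) +
      (cos (t + 1 / 2 * real 4 * pi) / fact 4) * (2 * y) ^ 4"
    using Maclaurin_cos_expansion[of "2 * y" 4] by blast
  have s: "(\<Sum>m<4. cos_coeff m * (2 * y) ^ m) = 1 - 2 * y\<^sup>2"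
    by (simp add: lessThan_nat_numeral cos_coeff_def fact_numeral power2_eq_square)
  have "cos (t + 1 / 2 * real 4 * pi) / fact 4 * (2 * y) ^ 4 \<le> 1 / fact 4 * (2 * y) ^ 4"
    by (intro mult_right_mono divide_right_mono) auto
  then have "cos (2 * y) \<le> 1 - 2 * y\<^sup>2 + 2 * y ^ 4 / 3"
    using t s by (simp add: eval_nat_numeral)
  moreover have "cos (2 * y) = 1 - 2 * (sin y)\<^sup>2"
    by (simp add: cos_double_sin)
  ultimately show ?thesis by simp
qed

text \<open>Termwise comparison of the power series: on the unit interval every odd power of
  \<open>x\<close> is at most \<open>x\<close>.\<close>

lemma sinh_le_mult_sinh_one:
  assumes "0 \<le> x" "x \<le> (1::real)"
  shows "sinh x \<le> x * sinh 1"
proof (rule sums_le[OF _ sinh_converges sums_mult[OF sinh_converges]])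
  show "(if even n then 0 else x ^ n /\<^sub>R fact n) \<le> x * (if even n then 0 else 1 ^ n /\<^sub>R fact n)" for n
  proof (cases n)
    case (Suc k)
    have "x ^ k \<le> 1" using assms by (simp add: power_le_one)
    then have "x * x ^ k \<le> x * 1" using assms by (intro mult_left_mono) auto
    then show ?thesis using Suc by (simp add: divide_right_mono field_class.field_divide_inverse mult_right_mono flip: mult.assoc del: fact_Suc)
  qed simp
qed

lemma sinh_squared_le:
  assumes "x\<^sup>2 \<le> (1::real)"
  shows "(sinh x)\<^sup>2 \<le> 139/100 * x\<^sup>2"
proof -
  have x1: "\<bar>x\<bar> \<le> 1" using assms by (simp add: abs_square_le_1)
  have "sinh \<bar>x\<bar> \<le> \<bar>x\<bar> * sinh 1" using x1 by (intro sinh_le_mult_sinh_one) auto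
  then have "(sinh \<bar>x\<bar>)\<^sup>2 \<le> (\<bar>x\<bar> * sinh 1)\<^sup>2"
    by (intro power_mono) auto
  then have 1: "(sinh x)\<^sup>2 \<le> x\<^sup>2 * (sinh 1)\<^sup>2"
    by (simp add: power_mult_distrib abs_if split: if_splits)
  have "1 / exp (1::real) \<ge> 1 / (2719/1000)"
    using exp_one_bounds by (intro divide_left_mono) auto
  then have "(367/1000::real) \<le> exp (- 1)" by (simp add: exp_minus field_simps)
  moreover have "sinh 1 = (exp 1 - exp (- 1)) / (2::real)"
    by (simp add: sinh_field_def)
  ultimately have "sinh 1 \<le> (1178/1000 :: real)" using exp_one_bounds by simp
  then have "(sinh 1)\<^sup>2 \<le> (1178/1000 :: real)\<^sup>2" by (intro power_mono) auto
  then have "(sinh 1)\<^sup>2 \<le> (139/100 :: real)" by (simp add: power2_eq_square)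
  then have "x\<^sup>2 * (sinh 1)\<^sup>2 \<le> x\<^sup>2 * (139/100)" by (intro mult_left_mono) auto
  then show ?thesis using 1 by simp
qed

lemma cmod_sinh_squared: "(cmod (sinh z))\<^sup>2 = (sinh (Re z))\<^sup>2 + (sin (Im z))\<^sup>2"
proof -
  have "Re (sinh z) = sinh (Re z) * cos (Im z)" "Im (sinh z) = cosh (Re z) * sin (Im z)"
    by (simp_all add: sinh_def cosh_def Re_exp Im_exp algebra_simps)
  then have "(cmod (sinh z))\<^sup>2 = (sinh (Re z))\<^sup>2 * (cos (Im z))\<^sup>2 + (cosh (Re z))\<^sup>2 * (sin (Im z))\<^sup>2"
    by (simp add: cmod_power2 power_mult_distrib)
  then show ?thesis by (simp add: cosh_square_eq cos_squared_eq algebra_simps)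
qed

lemma cmod_cosh_squared: "(cmod (cosh z))\<^sup>2 = 1 + (sinh (Re z))\<^sup>2 - (sin (Im z))\<^sup>2"
proof -
  have "Re (cosh z) = cosh (Re z) * cos (Im z)" "Im (cosh z) = sinh (Re z) * sin (Im z)"
    by (simp_all add: sinh_def cosh_def Re_exp Im_exp algebra_simps)
  then have "(cmod (cosh z))\<^sup>2 = (cosh (Re z))\<^sup>2 * (cos (Im z))\<^sup>2 + (sinh (Re z))\<^sup>2 * (sin (Im z))\<^sup>2"
    by (simp add: cmod_power2 power_mult_distrib)
  then show ?thesis by (simp add: cosh_square_eq cos_squared_eq algebra_simps)
qed

lemma abs_sinh_ge: "\<bar>x\<bar> \<le> \<bar>sinh (x::real)\<bar>"
  using real_le_abs_sinh[of x] by (simp add: sinh_field_def exp_minus)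

text \<open>This inequality makes the constant \<open>2 * exp 1 - 1\<close> work:
  \<open>cmod (sinh z) / cmod z\<close> stays large enough on the unit disc to beat
  \<open>exp 1 + cmod (cosh z)\<close>. Both moduli are estimated through the squares
  \<open>X\<close> and \<open>Y\<close> of the real and imaginary parts.\<close>

lemma cmod_sinh_dominates:
  fixes z :: complex
  assumes "cmod z \<le> 1" "z \<noteq> 0"
  shows "cmod z * (exp 1 + cmod (cosh z)) < (2 * exp 1 - 1) * cmod (sinh z)"
proof -
  define X Y where "X = (Re z)\<^sup>2" and "Y = (Im z)\<^sup>2"
  have XY: "(cmod z)\<^sup>2 = X + Y" "0 \<le> X" "0 \<le> Y"
    by (auto simp: X_def Y_def cmod_power2)
  have le1: "X + Y \<le> 1" using assms(1) XY(1) by (metis norm_ge_zero power_le_one)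
  have sinY: "Y - Y\<^sup>2 / 3 \<le> (sin (Im z))\<^sup>2"
    using sin_squared_ge[of "Im z"] by (simp add: Y_def flip: power_mult)
  have sinhX: "X \<le> (sinh (Re z))\<^sup>2"
    using abs_sinh_ge[of "Re z"] by (simp add: X_def abs_le_square_iff)
  have sinhX': "(sinh (Re z))\<^sup>2 \<le> 139/100 * X"
    unfolding X_def using XY le1 by (intro sinh_squared_le) (simp add: X_def)
  \<comment> \<open>\<open>s\<close> is an affine lower bound for
    \<open>cmod (sinh z) / cmod z\<close>. The slope \<open>19/100\<close> exceeds 1/6 by enough to
    give \<open>s\<^sup>2 \<le> 1 - Y / 3\<close> for all \<open>Y\<close> in the unit
    interval.\<close>
  define s where "s = 1 - 19/100 * Y"
  have s: "81/100 \<le> s" using le1 XY by (simp add: s_def)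
  have Y2: "Y\<^sup>2 \<le> Y" using XY le1 by (simp add: power2_eq_square mult_left_le)
  have "s\<^sup>2 \<le> 1 - Y / 3"
    using Y2 XY(3) by (simp add: s_def power2_eq_square algebra_simps)
  then have "(cmod z * s)\<^sup>2 \<le> (X + Y) * (1 - Y / 3)"
    unfolding power_mult_distrib XY(1) using XY by (intro mult_left_mono) auto
  also have "\<dots> = X + Y - Y\<^sup>2 / 3 - X * Y / 3"
    by (simp add: power2_eq_square algebra_simps)
  also have "\<dots> \<le> (cmod (sinh z))\<^sup>2"
    unfolding cmod_sinh_squared using sinY sinhX mult_nonneg_nonneg[OF XY(2,3)] by linarith
  finally have S: "cmod z * s \<le> cmod (sinh z)"
    by (rule power2_le_imp_le) simp
  have "(cmod (cosh z))\<^sup>2 \<le> 1 + 139/100 * X - Y + Y\<^sup>2 / 3"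
    unfolding cmod_cosh_squared using sinY sinhX' by linarith
  also have "\<dots> \<le> 239/100 - 205/100 * Y"
    using le1 Y2 XY by simp
  \<comment> \<open>Up to rounding, this affine function is
    \<open>(2 * s - 1) * (271/100) - s\<close>, the room left for \<open>cmod (cosh z)\<close> once
    \<open>exp 1\<close> is replaced by its lower bound 2.71.\<close>
  also have "\<dots> < (171/100 - 84/100 * Y)\<^sup>2"
  proof -
    have "(171/100 - 84/100 * Y)\<^sup>2 - (239/100 - 205/100 * Y) = (84/100 * Y - 48/100)\<^sup>2 + (3037/10000 - 164/10000 * Y)"
      by (simp add: power2_eq_square field_simps)
    moreover have "3037/10000 - 164/10000 * Y > 0" using le1 XY by simp
    ultimately show ?thesis by (smt (verit) zero_le_power2)
  qed
  finally have "cmod (cosh z) < 171/100 - 84/100 * Y"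
    by (rule power2_less_imp_less) (use le1 XY in simp)
  also have "\<dots> \<le> 442/100 * s - 271/100"
    using XY(3) unfolding s_def by (simp add: field_simps)
  also have "\<dots> \<le> (2 * s - 1) * exp 1 - s"
  proof -
    have "(2 * s - 1) * (271/100) \<le> (2 * s - 1) * exp 1"
      using s exp_one_bounds by (intro mult_left_mono) auto
    then show ?thesis by (simp add: field_simps)
  qed
  finally have "exp 1 + cmod (cosh z) < (2 * exp 1 - 1) * s"
    by (simp add: algebra_simps)
  then have "cmod z * (exp 1 + cmod (cosh z)) < cmod z * ((2 * exp 1 - 1) * s)"
    using assms(2) by (intro mult_strict_left_mono) auto
  also have "\<dots> \<le> (2 * exp 1 - 1) * cmod (sinh z)"
    using mult_left_mono[OF S, of "2 * exp 1 - 1"] exp_one_bounds by (simp add: mult_ac)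
  finally show ?thesis .
qed

text \<open>The difference quotient of \<open>Ln\<close> at 1 along the points
  \<open>1 + z / n\<close> tends to 1; multiply by \<open>z\<close> and exponentiate. For
  \<open>n > cmod z\<close> these points are nonzero, so that \<open>exp\<close> undoes
  \<open>Ln\<close>.\<close>

lemma complex_exp_limit: "(\<lambda>n. (1 + z / of_nat n) ^ n) \<longlonglongrightarrow> exp (z :: complex)"
proof (cases "z = 0")
  case False
  have "((\<lambda>w. (Ln w - Ln 1) / (w - 1)) \<longlongrightarrow> inverse 1) (at 1)"
    using has_field_derivative_Ln[of 1] unfolding has_field_derivative_iff by simp
  moreover have "filterlim (\<lambda>n. 1 + z / of_nat n) (at 1) sequentially"
    unfolding filterlim_at
  proof (rule conjI)
    show "\<forall>\<^sub>F n in sequentially. 1 + z / of_nat n \<in> UNIV \<and> 1 + z / of_nat n \<noteq> 1"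
      using False by (auto intro: eventually_mono[OF eventually_gt_at_top[of 0]])
    have "(\<lambda>n. 1 + z * (1 / of_nat n)) \<longlonglongrightarrow> 1 + z * 0"
      by (intro tendsto_intros lim_1_over_n)
    then show "(\<lambda>n. 1 + z / of_nat n) \<longlonglongrightarrow> 1" by simp
  qed
  ultimately have "(\<lambda>n. (Ln (1 + z / of_nat n) - Ln 1) / (1 + z / of_nat n - 1)) \<longlonglongrightarrow> inverse 1"
    by (rule filterlim_compose)
  then have "(\<lambda>n. exp (z * ((Ln (1 + z / of_nat n) - Ln 1) / (1 + z / of_nat n - 1)))) \<longlonglongrightarrow> exp (z * inverse 1)"
    by (intro tendsto_intros)
  moreover have "\<forall>\<^sub>F n in sequentially.
      exp (z * ((Ln (1 + z / of_nat n) - Ln 1) / (1 + z / of_nat n - 1))) = (1 + z / of_nat n) ^ n"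
    using eventually_gt_at_top[of "nat \<lceil>cmod z\<rceil>"]
  proof eventually_elim
    case (elim n)
    then have n: "cmod z < real n" by linarith
    then have "real n > 0" by (smt (verit) norm_ge_zero)
    have "1 + z / of_nat n \<noteq> 0"
    proof
      assume "1 + z / of_nat n = 0"
      then have "z = - of_nat n" using \<open>real n > 0\<close> by (simp add: field_simps add_eq_0_iff)
      then show False using n by simp
    qed
    then show ?case
      using False \<open>real n > 0\<close> by (simp add: exp_of_nat2_mult)
  qed
  ultimately show ?thesis by (auto intro: Lim_transform_eventually)
qed simp

lemma cmod_sum_diff_squared:
  "(cmod (x + y))\<^sup>2 + (cmod (x - y))\<^sup>2 = 2 * ((cmod x)\<^sup>2 + (cmod y)\<^sup>2)"
  unfolding cmod_power2 by (simp add: power2_eq_square algebra_simps)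

text \<open>
  Maximum principle for the vector-valued map \<open>w \<mapsto> (E w, r Q w)\<close> on the disc of radius \<open>r\<^sup>2\<close>.
\<close>

lemma even_odd_bound:
  fixes E Q :: "complex poly"
  assumes bound: "\<And>z. cmod z \<le> r \<Longrightarrow> cmod (poly E (z\<^sup>2) + z * poly Q (z\<^sup>2)) \<le> M"
    and "cmod \<delta> < r"
  shows "(cmod (poly E (\<delta>\<^sup>2)))\<^sup>2 + r\<^sup>2 * (cmod (poly Q (\<delta>\<^sup>2)))\<^sup>2 \<le> M\<^sup>2"
proof -
  define e q where "e = poly E (\<delta>\<^sup>2)" and "q = poly Q (\<delta>\<^sup>2)"
  define S where "S = (cmod e)\<^sup>2 + r\<^sup>2 * (cmod q)\<^sup>2"
  have r: "0 < r" using assms(2) by (smt (verit) norm_ge_zero)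
  have M: "0 \<le> M" using bound[of 0] r by (smt (verit) norm_ge_zero norm_zero)
  \<comment> \<open>Pairing the map with its own value at \<open>\<delta>\<^sup>2\<close> leaves a
    scalar holomorphic function whose value there is exactly \<open>S\<close>, while Cauchy-Schwarz
    bounds it by \<open>sqrt S * M\<close> on the boundary.\<close>
  define F where "F = (\<lambda>w. cnj e * poly E w + of_real (r\<^sup>2) * cnj q * poly Q w)"
  have "cmod (F (\<delta>\<^sup>2)) \<le> sqrt S * M"
  proof (rule maximum_modulus_frontier[where S = "ball 0 (r\<^sup>2)" and f = F])
    show "F holomorphic_on interior (ball 0 (r\<^sup>2))"
      unfolding F_def by (intro holomorphic_intros)
    show "continuous_on (closure (ball 0 (r\<^sup>2))) F"
      unfolding F_def by (intro continuous_intros)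
    show "\<delta>\<^sup>2 \<in> ball 0 (r\<^sup>2)"
      using assms(2) r by (simp add: norm_power power_strict_mono)
    fix w :: complex
    assume "w \<in> frontier (ball 0 (r\<^sup>2))"
    then have w: "cmod w = r\<^sup>2" using r by simp
    define z where "z = csqrt w"
    have z: "z\<^sup>2 = w" "cmod z = r" using w r by (auto simp: z_def norm_csqrt real_sqrt_abs)
    \<comment> \<open>Both square roots \<open>z\<close> and \<open>-z\<close> of \<open>w\<close>
      lie in the disc, so the parallelogram law applies to the two bounds.\<close>
    have "(cmod (poly E w + z * poly Q w))\<^sup>2 \<le> M\<^sup>2" "(cmod (poly E w - z * poly Q w))\<^sup>2 \<le> M\<^sup>2"
      using bound[of z] bound[of "-z"] z by (auto intro!: power_mono)
    then have 1: "(cmod (poly E w))\<^sup>2 + (r * cmod (poly Q w))\<^sup>2 \<le> M\<^sup>2"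
      using cmod_sum_diff_squared[of "poly E w" "z * poly Q w"] z by (simp add: norm_mult)
    have "cmod (F w) \<le> cmod e * cmod (poly E w) + (r * cmod q) * (r * cmod (poly Q w))"
      unfolding F_def by (rule order.trans[OF norm_triangle_ineq]) (simp add: norm_mult power2_eq_square norm_power)
    also have "\<dots> \<le> sqrt ((cmod e)\<^sup>2 + (r * cmod q)\<^sup>2) * sqrt ((cmod (poly E w))\<^sup>2 + (r * cmod (poly Q w))\<^sup>2)"
    proof -
      have "(cmod e * cmod (poly E w) + (r * cmod q) * (r * cmod (poly Q w)))\<^sup>2
          \<le> ((cmod e)\<^sup>2 + (r * cmod q)\<^sup>2) * ((cmod (poly E w))\<^sup>2 + (r * cmod (poly Q w))\<^sup>2)"
        using zero_le_power2[of "cmod e * (r * cmod (poly Q w)) - (r * cmod q) * cmod (poly E w)"]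
        by (simp add: power2_eq_square algebra_simps)
      then show ?thesis by (metis real_le_rsqrt real_sqrt_mult)
    qed
    also have "\<dots> \<le> sqrt S * M"
      using 1 M by (intro mult_mono) (auto simp: S_def power_mult_distrib intro: real_le_lsqrt)
    finally show "cmod (F w) \<le> sqrt S * M" .
  qed simp
  moreover have "F (\<delta>\<^sup>2) = of_real S"
    by (simp add: F_def S_def e_def q_def complex_norm_square mult_ac del: of_real_power)
  moreover have S0: "0 \<le> S" by (simp add: S_def)
  ultimately have "S \<le> sqrt S * M" by simp
  then have "sqrt S * sqrt S \<le> sqrt S * M" unfolding real_sqrt_mult_self using S0 by simp
  then have "sqrt S \<le> M"
    using M S0 by (cases "S = 0") (simp_all add: mult_le_cancel_left_pos del: real_sqrt_mult_self)
  then show ?thesis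
    using S0 by (simp add: S_def e_def q_def sqrt_le_D)
qed

text \<open>Replaces the maximum principle when only the two eigenvalues are available: then
  \<open>x\<close> is the even part and \<open>y\<close> is \<open>\<delta>\<close> times the odd
  factor.\<close>

lemma parallelogram_bound:
  fixes x y :: complex
  assumes "cmod (x + y) \<le> M" "cmod (x - y) \<le> M"
  shows "(cmod x)\<^sup>2 + (cmod y)\<^sup>2 \<le> M\<^sup>2"
proof -
  have "(cmod (x + y))\<^sup>2 \<le> M\<^sup>2" "(cmod (x - y))\<^sup>2 \<le> M\<^sup>2"
    using assms by (auto intro!: power_mono)
  then show ?thesis using cmod_sum_diff_squared[of x y] by simp
qed

text \<open>Cauchy-Schwarz against the vector \<open>(1, K)\<close>; the defect is the square of
  \<open>y - K * x\<close>.\<close>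

lemma add_mult_le_sqrt:
  fixes x y K M :: real
  assumes "x\<^sup>2 + y\<^sup>2 \<le> M\<^sup>2" "0 \<le> M"
  shows "x + K * y \<le> sqrt (1 + K\<^sup>2) * M"
proof -
  have "(x + K * y)\<^sup>2 \<le> (1 + K\<^sup>2) * (x\<^sup>2 + y\<^sup>2)"
    using zero_le_power2[of "y - K * x"] by (simp add: power2_eq_square algebra_simps)
  also have "\<dots> \<le> (1 + K\<^sup>2) * M\<^sup>2" using assms by (intro mult_left_mono) auto
  finally have "x + K * y \<le> sqrt ((1 + K\<^sup>2) * M\<^sup>2)" by (rule real_le_rsqrt)
  then show ?thesis using assms by (simp add: real_sqrt_mult)
qed

section \<open>Scalar arithmetic and the span of the unit and one element\<close>

lemma complex_ring_simps [simp]: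
  "x \<in> carrier complex_ring" "x \<oplus>\<^bsub>complex_ring\<^esub> y = x + y"
  "x \<otimes>\<^bsub>complex_ring\<^esub> y = x * y" "\<one>\<^bsub>complex_ring\<^esub> = 1" "\<zero>\<^bsub>complex_ring\<^esub> = 0"
  by (simp_all add: complex_ring_def)

lemma complex_ring_uminus [simp]: "\<ominus>\<^bsub>complex_ring\<^esub> x = - x"
proof -
  interpret cring complex_ring by (rule cring_complex_ring)
  show ?thesis by (rule minus_equality) auto
qed

context unital_banach_algebra
begin

lemma smult_add: "x \<in> carrier A \<Longrightarrow> (c + d) \<odot> x = c \<odot> x \<oplus> d \<odot> x"
  using smult_l_distr[of c d x] by simp

lemma smult_smult: "x \<in> carrier A \<Longrightarrow> c \<odot> (d \<odot> x) = (c * d) \<odot> x"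
  using smult_assoc1[of c d x] by simp

lemma smult_add_right: "x \<in> carrier A \<Longrightarrow> y \<in> carrier A \<Longrightarrow> c \<odot> (x \<oplus> y) = c \<odot> x \<oplus> c \<odot> y"
  using smult_r_distr[of c x y] by simp

lemma one_smult: "x \<in> carrier A \<Longrightarrow> 1 \<odot> x = x"
  using smult_one[of x] by simp

lemma zero_smult: "x \<in> carrier A \<Longrightarrow> 0 \<odot> x = \<zero>"
  using smult_l_null[of x] by simp

lemma smult_zero: "c \<odot> \<zero> = \<zero>"
  using smult_r_null[of c] by simp

lemma smult_in: "x \<in> carrier A \<Longrightarrow> c \<odot> x \<in> carrier A"
  by (rule smult_closed) auto

lemma minus_one_smult: "x \<in> carrier A \<Longrightarrow> (- 1) \<odot> x = \<ominus> x"
  using smult_l_minus[of 1 x] by (simp add: one_smult)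

lemma nrm_uminus: "x \<in> carrier A \<Longrightarrow> nrm A (\<ominus> x) = nrm A x"
  using nrm_smult[of x "- 1"] by (simp add: minus_one_smult)

lemma nrm_zero: "nrm A \<zero> = 0"
  by (simp add: nrm_eq_0_iff)

lemma nrm_diff:
  assumes "x \<in> carrier A" "y \<in> carrier A"
  shows "nrm A x - nrm A y \<le> nrm A (x \<oplus> y)"
proof -
  have "x = (x \<oplus> y) \<oplus> \<ominus> y" using assms by (simp add: a_assoc r_neg)
  then show ?thesis
    using nrm_triangle[of "x \<oplus> y" "\<ominus> y"] assms by (simp add: nrm_uminus)
qed

text \<open>When the square of \<open>b\<close> is a multiple of the unit, these elements are closed
  under multiplication, so computations reduce to pairs of complex coefficients.\<close>

definition lin :: "'a \<Rightarrow> complex \<Rightarrow> complex \<Rightarrow> 'a" where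
  "lin b x y = x \<odot> \<one> \<oplus> y \<odot> b"

lemma lin_closed [simp]: "b \<in> carrier A \<Longrightarrow> lin b x y \<in> carrier A"
  by (simp add: lin_def smult_in)

lemma lin_add:
  assumes "b \<in> carrier A"
  shows "lin b x y \<oplus> lin b x' y' = lin b (x + x') (y + y')"
proof -
  have "x \<odot> \<one> \<in> carrier A" "x' \<odot> \<one> \<in> carrier A" "y \<odot> b \<in> carrier A" "y' \<odot> b \<in> carrier A"
    using assms by (simp_all add: smult_in)
  then show ?thesis
    using assms by (simp add: lin_def smult_add a_ac)
qed

lemma smult_lin: "b \<in> carrier A \<Longrightarrow> c \<odot> lin b x y = lin b (c * x) (c * y)"
  by (simp add: lin_def smult_add_right smult_smult smult_in)

lemma lin_mult:
  assumes "b \<in> carrier A" "b \<otimes> b = d \<odot> \<one>"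
  shows "lin b x y \<otimes> lin b x' y' = lin b (x * x' + d * y * y') (x * y' + y * x')"
proof -
  have 1: "lin b x y \<otimes> \<one> = lin b x y" using assms by simp
  have 2: "lin b x y \<otimes> b = lin b (d * y) x"
    using assms by (simp add: lin_def l_distr smult_mult_left smult_smult smult_in a_comm mult.commute)
  have "lin b x y \<otimes> lin b x' y' = x' \<odot> (lin b x y \<otimes> \<one>) \<oplus> y' \<odot> (lin b x y \<otimes> b)"
    using assms unfolding lin_def[of b x' y']
    by (simp add: r_distr smult_mult_right smult_in)
  also have "\<dots> = lin b (x' * x + y' * (d * y)) (x' * y + y' * x)"
    unfolding 1 2 using assms by (simp add: smult_lin lin_add)
  finally show ?thesis by (simp add: algebra_simps)
qed

lemma nrm_lin_le: "b \<in> carrier A \<Longrightarrow> nrm A (lin b x y) \<le> cmod x + cmod y * nrm A b"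
  unfolding lin_def by (rule order.trans[OF nrm_triangle]) (auto simp: smult_in nrm_smult nrm_one)

lemma nrm_lin_ge: "b \<in> carrier A \<Longrightarrow> cmod y * nrm A b - cmod x \<le> nrm A (lin b x y)"
  unfolding lin_def using nrm_diff[of "y \<odot> b" "x \<odot> \<one>"]
  by (simp add: smult_in nrm_smult nrm_one a_comm)

subsection \<open>States and the Hahn--Banach theorem\<close>

text \<open>The norm condition is stated as a pointwise inequality, which avoids the supremum in
  \<open>dual_norm\<close>; the value 1 at the unit then makes the dual norm exactly one.\<close>

definition state :: "('a \<Rightarrow> complex) \<Rightarrow> bool" where
  "state \<phi> \<longleftrightarrow> (\<forall>x\<in>carrier A. \<forall>y\<in>carrier A. \<phi> (x \<oplus> y) = \<phi> x + \<phi> y) \<and>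
     (\<forall>c. \<forall>x\<in>carrier A. \<phi> (c \<odot> x) = c * \<phi> x) \<and>
     (\<forall>x\<in>carrier A. cmod (\<phi> x) \<le> nrm A x) \<and> \<phi> \<one> = 1"

text \<open>From left to right, the supremum is attained at the unit. Conversely, elements are
  scaled to norm one; the constant \<open>K\<close> from membership in the dual bounds the set under
  the supremum and settles elements of norm zero.\<close>

lemma state_iff: "state \<phi> \<longleftrightarrow> \<phi> \<in> dual A \<and> dual_norm A \<phi> = 1 \<and> \<phi> \<one> = 1"
proof
  assume st: "state \<phi>"
  then have "\<phi> \<in> dual A"
    unfolding state_def dual_def by (auto intro!: exI[of _ 1])
  moreover have "dual_norm A \<phi> = 1"
    unfolding dual_norm_def
  proof (rule cSup_eq_maximum)
    show "1 \<in> {cmod (\<phi> x) |x. x \<in> carrier A \<and> nrm A x \<le> 1}"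
      using st nrm_one by (auto simp: state_def intro!: exI[of _ \<one>])
  qed (use st in \<open>force simp: state_def\<close>)
  ultimately show "\<phi> \<in> dual A \<and> dual_norm A \<phi> = 1 \<and> \<phi> \<one> = 1"
    using st by (simp add: state_def)
next
  assume r: "\<phi> \<in> dual A \<and> dual_norm A \<phi> = 1 \<and> \<phi> \<one> = 1"
  then have smult: "\<phi> (c \<odot> x) = c * \<phi> x" if "x \<in> carrier A" for c x
    using that by (simp add: dual_def)
  from r obtain K where K: "cmod (\<phi> x) \<le> K * nrm A x" if "x \<in> carrier A" for x
    unfolding dual_def by blast
  have bdd: "bdd_above {cmod (\<phi> x) |x. x \<in> carrier A \<and> nrm A x \<le> 1}"
  proof (rule bdd_aboveI)
    fix t assume "t \<in> {cmod (\<phi> x) |x. x \<in> carrier A \<and> nrm A x \<le> 1}"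
    then obtain x where x: "t = cmod (\<phi> x)" "x \<in> carrier A" "nrm A x \<le> 1" by auto
    have "K * nrm A x \<le> \<bar>K\<bar> * 1"
      using x nrm_nonneg[of x] by (intro mult_mono) auto
    then show "t \<le> \<bar>K\<bar>" using K[of x] x by simp
  qed
  have le1: "cmod (\<phi> x) \<le> 1" if "x \<in> carrier A" "nrm A x \<le> 1" for x
    using cSup_upper[OF _ bdd, of "cmod (\<phi> x)"] r that by (auto simp: dual_norm_def)
  have "cmod (\<phi> x) \<le> nrm A x" if x: "x \<in> carrier A" for x
  proof (cases "nrm A x = 0")
    case True
    then show ?thesis using K[of x] x by simp
  next
    case False
    then have pos: "0 < nrm A x" using nrm_nonneg[of x] x by simp
    have "cmod (\<phi> (of_real (inverse (nrm A x)) \<odot> x)) \<le> 1"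
      using x pos by (intro le1) (auto simp: smult_in nrm_smult simp del: of_real_inverse)
    then show ?thesis using pos x by (simp add: smult norm_mult norm_divide field_simps)
  qed
  then show "state \<phi>" using r by (simp add: state_def dual_def)
qed

lemma numerical_range_eq: "numerical_range a A = {\<phi> a |\<phi>. state \<phi>}"
  by (simp add: numerical_range_def state_iff)

section \<open>Sublinear functionals and dominated linear functionals\<close>

definition sublinear :: "('a \<Rightarrow> real) \<Rightarrow> bool" where
  "sublinear f \<longleftrightarrow> (\<forall>x\<in>carrier A. \<forall>y\<in>carrier A. f (x \<oplus> y) \<le> f x + f y) \<and>
     (\<forall>t\<ge>0. \<forall>x\<in>carrier A. f (of_real t \<odot> x) = t * f x)"

lemma sublinear_zero: "sublinear f \<Longrightarrow> f \<zero> = 0"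
  unfolding sublinear_def using zero_smult[of \<zero>] by (metis mult_zero_left of_real_0 order_refl zero_closed)

lemma sublinear_uminus:
  assumes "sublinear f" "x \<in> carrier A"
  shows "- f (\<ominus> x) \<le> f x"
proof -
  have "f (x \<oplus> \<ominus> x) \<le> f x + f (\<ominus> x)"
    using assms by (simp add: sublinear_def)
  then show ?thesis using sublinear_zero[OF assms(1)] assms by (simp add: r_neg)
qed

lemma sublinear_nrm: "sublinear (nrm A)"
  by (simp add: sublinear_def nrm_triangle nrm_smult)

text \<open>The usual Hahn-Banach modification: it pushes \<open>f\<close> down until its value at
  \<open>\<ominus> x\<close> is at most \<open>- f x\<close>. A linear functional below it is
  therefore at least \<open>f x\<close> at \<open>x\<close>.\<close>

definition lower :: "('a \<Rightarrow> real) \<Rightarrow> 'a \<Rightarrow> 'a \<Rightarrow> real" where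
  "lower f x y = (INF t\<in>{0..}. f (y \<oplus> of_real t \<odot> x) - t * f x)"

context
  fixes f x assumes f: "sublinear f" and x: "x \<in> carrier A"
begin

text \<open>The infimum is a genuine one, since subadditivity bounds all its terms from below by
  \<open>- f (\<ominus> y)\<close>.\<close>

lemma lower_le:
  assumes y: "y \<in> carrier A" and t: "0 \<le> t"
  shows "lower f x y \<le> f (y \<oplus> of_real t \<odot> x) - t * f x"
  unfolding lower_def
proof (rule cINF_lower)
  show "bdd_below ((\<lambda>t. f (y \<oplus> of_real t \<odot> x) - t * f x) ` {0..})"
  proof (rule bdd_belowI2)
    fix t :: real assume t: "t \<in> {0..}"
    define z where "z = complex_of_real t \<odot> x"
    have z: "z \<in> carrier A" using x by (simp add: z_def smult_in)
    have "z = (y \<oplus> z) \<oplus> \<ominus> y" using y z by (simp add: a_comm[of y] a_assoc r_neg)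
    then have "f z \<le> f (y \<oplus> z) + f (\<ominus> y)"
      using f y z by (metis sublinear_def a_closed a_inv_closed)
    moreover have "f z = t * f x"
      using f x t by (simp add: sublinear_def z_def)
    ultimately show "- f (\<ominus> y) \<le> f (y \<oplus> of_real t \<odot> x) - t * f x"
      by (simp add: z_def)
  qed
qed (use t in auto)

lemma lower_greatest:
  assumes "\<And>t. 0 \<le> t \<Longrightarrow> c \<le> f (y \<oplus> of_real t \<odot> x) - t * f x"
  shows "c \<le> lower f x y"
  unfolding lower_def using assms by (intro cINF_greatest) auto

lemma lower_le_self: "y \<in> carrier A \<Longrightarrow> lower f x y \<le> f y"
  using lower_le[of y 0] x by (simp add: zero_smult)

lemma lower_uminus: "lower f x (\<ominus> x) \<le> - f x"
  using lower_le[of "\<ominus> x" 1] x by (simp add: one_smult l_neg sublinear_zero[OF f])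

text \<open>For subadditivity the parameters \<open>s\<close> and \<open>t\<close> of the two infima
  add up. For homogeneity a positive factor rescales the parameter, which gives one inequality; the
  same inequality for the inverse factor gives the other.\<close>

lemma sublinear_lower: "sublinear (lower f x)"
  unfolding sublinear_def
proof (intro conjI ballI allI impI)
  fix y z assume yz: "y \<in> carrier A" "z \<in> carrier A"
  have *: "lower f x (y \<oplus> z) \<le> (f (y \<oplus> of_real s \<odot> x) - s * f x) + (f (z \<oplus> of_real t \<odot> x) - t * f x)"
    if st: "0 \<le> s" "0 \<le> t" for s t
  proof -
    have "(y \<oplus> z) \<oplus> of_real (s + t) \<odot> x = (y \<oplus> of_real s \<odot> x) \<oplus> (z \<oplus> of_real t \<odot> x)"
      using yz x smult_in[OF x] by (simp add: smult_add a_ac)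
    then have "f ((y \<oplus> z) \<oplus> of_real (s + t) \<odot> x) \<le> f (y \<oplus> of_real s \<odot> x) + f (z \<oplus> of_real t \<odot> x)"
      using f yz x smult_in[OF x] by (simp add: sublinear_def)
    then show ?thesis
      using lower_le[of "y \<oplus> z" "s + t"] yz st by (simp add: algebra_simps)
  qed
  have "lower f x (y \<oplus> z) - (f (y \<oplus> of_real s \<odot> x) - s * f x) \<le> lower f x z" if "0 \<le> s" for s
    by (rule lower_greatest) (use *[OF that] in \<open>simp add: algebra_simps\<close>)
  then have "lower f x (y \<oplus> z) - lower f x z \<le> lower f x y"
    by (intro lower_greatest) (simp add: algebra_simps)
  then show "lower f x (y \<oplus> z) \<le> lower f x y + lower f x z" by simp
next
  have le: "lower f x (of_real c \<odot> y) \<le> c * lower f x y" if c: "0 < c" and y: "y \<in> carrier A" for c y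
  proof -
    have "lower f x (of_real c \<odot> y) / c \<le> f (y \<oplus> of_real t \<odot> x) - t * f x" if t: "0 \<le> t" for t
    proof -
      have "of_real c \<odot> y \<oplus> of_real (c * t) \<odot> x = of_real c \<odot> (y \<oplus> of_real t \<odot> x)"
        using x y by (simp add: smult_add_right smult_smult smult_in)
      then have "f (of_real c \<odot> y \<oplus> of_real (c * t) \<odot> x) = c * f (y \<oplus> of_real t \<odot> x)"
        using f c x y by (simp add: sublinear_def smult_in)
      then show ?thesis
        using lower_le[of "of_real c \<odot> y" "c * t"] c t y by (simp add: smult_in field_simps)
    qed
    then have "lower f x (of_real c \<odot> y) / c \<le> lower f x y" by (rule lower_greatest)
    then show ?thesis using c by (simp add: field_simps)
  qed
  fix c :: real and y assume c: "0 \<le> c" and y: "y \<in> carrier A"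
  show "lower f x (of_real c \<odot> y) = c * lower f x y"
  proof (cases "c = 0")
    case True
    have "f (\<zero> \<oplus> of_real t \<odot> x) - t * f x = 0" if "0 \<le> t" for t
      using f x that by (simp add: sublinear_def smult_in)
    then show ?thesis using True y by (simp add: zero_smult lower_def)
  next
    case False
    with c have c: "0 < c" by simp
    have "lower f x (of_real (1 / c) \<odot> (of_real c \<odot> y)) \<le> 1 / c * lower f x (of_real c \<odot> y)"
      using c y by (intro le) (auto simp: smult_in)
    moreover have "of_real (1 / c) \<odot> (of_real c \<odot> y) = y"
      using c y by (simp add: smult_smult one_smult)
    ultimately show ?thesis
      using le[OF c y] c by (simp add: field_simps)
  qed
qed

end

text \<open>A pointwise minimal sublinear functional \<open>m\<close> equals every \<open>lower m x\<close>, hence is odd, hence linear.\<close>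

lemma exists_minimal_sublinear:
  assumes p: "sublinear p"
  obtains m where "sublinear m" "\<And>x. x \<in> carrier A \<Longrightarrow> m x \<le> p x"
    "\<And>f. sublinear f \<Longrightarrow> \<forall>x\<in>carrier A. f x \<le> m x \<Longrightarrow> \<forall>x\<in>carrier A. f x = m x"
proof -
  \<comment> \<open>Values off the carrier are pinned to 0; otherwise they could be lowered forever
    and no minimal element would exist. The order \<open>P\<close> is reversed because Zorn's lemma
    yields maximal elements.\<close>
  define S where "S = {f. sublinear f \<and> (\<forall>x\<in>carrier A. f x \<le> p x) \<and> (\<forall>x. x \<notin> carrier A \<longrightarrow> f x = 0)}"
  define P where "P = (\<lambda>(f :: 'a \<Rightarrow> real) g. \<forall>x. g x \<le> f x)"
  have restrict: "sublinear (\<lambda>x. if x \<in> carrier A then f x else 0)" if "sublinear f" for f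
    using that by (simp add: sublinear_def smult_in)
  have "\<exists>m\<in>S. \<forall>f\<in>S. P m f \<longrightarrow> f = m"
  proof (rule predicate_Zorn)
    show "partial_order_on S (relation_of P S)"
      by (rule partial_order_on_relation_ofI) (auto simp: P_def intro: order.trans intro!: ext order.antisym)
    fix C assume "C \<in> Chains (relation_of P S)"
    then have CS: "C \<subseteq> S" and chain: "\<And>f g. f \<in> C \<Longrightarrow> g \<in> C \<Longrightarrow> P f g \<or> P g f"
      by (auto simp: Chains_def relation_of_def)
    show "\<exists>u\<in>S. \<forall>f\<in>C. P f u"
    proof (cases "C = {}")
      case True
      have "(\<lambda>x. if x \<in> carrier A then p x else 0) \<in> S"
        using restrict[OF p] by (simp add: S_def)
      then show ?thesis using True by blast
    next
      case False
      define u where "u = (\<lambda>x. if x \<in> carrier A then INF f\<in>C. f x else 0)"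
      have C: "sublinear f" "\<And>x. x \<in> carrier A \<Longrightarrow> f x \<le> p x" "\<And>x. x \<notin> carrier A \<Longrightarrow> f x = 0"
        if "f \<in> C" for f using CS that by (auto simp: S_def)
      have bdd: "bdd_below ((\<lambda>f. f x) ` C)" if x: "x \<in> carrier A" for x
      proof (rule bdd_belowI2)
        fix f assume f: "f \<in> C"
        show "- p (\<ominus> x) \<le> f x"
          using sublinear_uminus[OF C(1)[OF f] x] C(2)[OF f, of "\<ominus> x"] x by simp
      qed
      have u_le: "u x \<le> f x" if "f \<in> C" for f x
        using C(3)[OF that, of x] cINF_lower[OF bdd that, of x] by (cases "x \<in> carrier A") (simp_all add: u_def)
      have u_ge: "c \<le> u x" if "x \<in> carrier A" "\<And>f. f \<in> C \<Longrightarrow> c \<le> f x" for c x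
        using that False by (auto simp: u_def intro: cINF_greatest)
      have add: "u (x \<oplus> y) \<le> u x + u y" if xy: "x \<in> carrier A" "y \<in> carrier A" for x y
      proof -
        \<comment> \<open>The smaller of two members of the chain bounds both summands at once, so
          the pointwise infimum stays subadditive.\<close>
        have *: "u (x \<oplus> y) \<le> f x + g y" if fg: "f \<in> C" "g \<in> C" for f g
        proof -
          obtain h where h: "h \<in> C" "h x \<le> f x" "h y \<le> g y"
            using chain[OF fg] fg unfolding P_def by fastforce
          have "u (x \<oplus> y) \<le> h (x \<oplus> y)" using h(1) by (rule u_le)
          also have "\<dots> \<le> h x + h y" using C(1)[OF h(1)] xy by (simp add: sublinear_def)
          finally show ?thesis using h by simp
        qed
        have "u (x \<oplus> y) - f x \<le> u y" if "f \<in> C" for f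
          by (rule u_ge) (use *[OF that] xy in \<open>auto simp: algebra_simps\<close>)
        then have "u (x \<oplus> y) - u y \<le> u x"
          by (intro u_ge) (use xy in \<open>auto simp: algebra_simps\<close>)
        then show ?thesis by simp
      qed
      have le: "u (of_real c \<odot> x) \<le> c * u x" if c: "0 < c" and x: "x \<in> carrier A" for c x
      proof -
        have "u (of_real c \<odot> x) / c \<le> u x"
        proof (rule u_ge[OF x])
          fix f assume f: "f \<in> C"
          have "u (of_real c \<odot> x) \<le> f (of_real c \<odot> x)" using f by (rule u_le)
          also have "\<dots> = c * f x" using C(1)[OF f] c x by (simp add: sublinear_def)
          finally show "u (of_real c \<odot> x) / c \<le> f x" using c by (simp add: field_simps)
        qed
        then show ?thesis using c by (simp add: field_simps)
      qed
      have hom: "u (of_real c \<odot> x) = c * u x" if c: "0 \<le> c" and x: "x \<in> carrier A" for c x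
      proof (cases "c = 0")
        case True
        have "f \<zero> = 0" if "f \<in> C" for f using C(1)[OF that] by (rule sublinear_zero)
        moreover obtain f where "f \<in> C" using \<open>C \<noteq> {}\<close> by blast
        ultimately have "u \<zero> = 0"
          using u_ge[of \<zero> 0] u_le[of f \<zero>] by fastforce
        then show ?thesis using True x by (simp add: zero_smult)
      next
        case False
        with c have c: "0 < c" by simp
        have "u (of_real (1 / c) \<odot> (of_real c \<odot> x)) \<le> 1 / c * u (of_real c \<odot> x)"
          using c x by (intro le) (auto simp: smult_in)
        moreover have "of_real (1 / c) \<odot> (of_real c \<odot> x) = x"
          using c x by (simp add: smult_smult one_smult)
        ultimately show ?thesis
          using le[OF c x] c by (simp add: field_simps)
      qed
      obtain f where "f \<in> C" using False by blast
      then have "u x \<le> p x" if "x \<in> carrier A" for x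
        using u_le C(2) that by (meson order.trans)
      then have "u \<in> S" using add hom by (simp add: S_def sublinear_def) (simp add: u_def)
      then show ?thesis using u_le by (auto simp: P_def)
    qed
  qed
  then obtain m where m: "m \<in> S" "\<And>f. f \<in> S \<Longrightarrow> P m f \<Longrightarrow> f = m" by blast
  show ?thesis
  proof
    show "sublinear m" using m(1) by (simp add: S_def)
    show "m x \<le> p x" if "x \<in> carrier A" for x
      using m(1) that by (simp add: S_def)
    fix f assume f: "sublinear f" "\<forall>x\<in>carrier A. f x \<le> m x"
    define g where "g = (\<lambda>x. if x \<in> carrier A then f x else 0)"
    have "g \<in> S" using f restrict[OF f(1)] m(1) by (force simp: S_def g_def)
    moreover have "P m g" using f m(1) by (simp add: P_def g_def S_def)
    ultimately have "g = m" by (rule m(2))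
    then show "\<forall>x\<in>carrier A. f x = m x" by (metis g_def)
  qed
qed

lemma exists_linear_le:
  assumes p: "sublinear p"
  obtains f where "\<And>x y. x \<in> carrier A \<Longrightarrow> y \<in> carrier A \<Longrightarrow> f (x \<oplus> y) = f x + f y"
    "\<And>t x. x \<in> carrier A \<Longrightarrow> f (of_real t \<odot> x) = t * f x"
    "\<And>x. x \<in> carrier A \<Longrightarrow> f x \<le> p x"
proof -
  obtain m where m: "sublinear m" "\<And>x. x \<in> carrier A \<Longrightarrow> m x \<le> p x"
    "\<And>f. sublinear f \<Longrightarrow> \<forall>x\<in>carrier A. f x \<le> m x \<Longrightarrow> \<forall>x\<in>carrier A. f x = m x"
    using exists_minimal_sublinear[OF p] by blast
  have odd: "m (\<ominus> x) = - m x" if x: "x \<in> carrier A" for x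
  proof -
    have "lower m x (\<ominus> x) = m (\<ominus> x)"
      using m(3)[OF sublinear_lower[OF m(1) x]] lower_le_self[OF m(1) x] x by simp
    then have "m (\<ominus> x) \<le> - m x" using lower_uminus[OF m(1) x] by simp
    then show ?thesis using sublinear_uminus[OF m(1) x] by simp
  qed
  show ?thesis
  proof (rule that[of m])
    fix x y assume xy: "x \<in> carrier A" "y \<in> carrier A"
    have "m (\<ominus> x \<oplus> \<ominus> y) \<le> m (\<ominus> x) + m (\<ominus> y)" "m (x \<oplus> y) \<le> m x + m y"
      using m(1) xy by (auto simp: sublinear_def)
    moreover have "\<ominus> x \<oplus> \<ominus> y = \<ominus> (x \<oplus> y)" using xy by (simp add: minus_add)
    ultimately show "m (x \<oplus> y) = m x + m y" using odd xy by simp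
  next
    fix t :: real and x assume x: "x \<in> carrier A"
    have pos: "m (of_real s \<odot> x) = s * m x" if "0 \<le> s" for s
      using that m(1) x by (simp add: sublinear_def)
    show "m (of_real t \<odot> x) = t * m x"
    proof (cases "0 \<le> t")
      case False
      have "of_real t \<odot> x = \<ominus> (of_real (- t) \<odot> x)"
        using x by (simp add: smult_smult smult_in flip: minus_one_smult)
      then show ?thesis using pos[of "- t"] odd False x by (simp add: smult_in)
    qed (rule pos)
  next
    show "m x \<le> p x" if "x \<in> carrier A" for x using that by (rule m(2))
  qed
qed

text \<open>The norm is modified twice. Lowering it at the unit forces \<open>f \<one> = 1\<close>
  and gives \<open>p x\<close> as the infimum of the terms in the hypothesis on \<open>h\<close>;
  lowering \<open>p\<close> at \<open>x\<close> forces \<open>f x\<close> to be at least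
  \<open>p x\<close>. The state is the complexification of \<open>f\<close>.\<close>

lemma exists_state_Re_ge:
  assumes x: "x \<in> carrier A" and h: "\<And>t. 0 \<le> t \<Longrightarrow> h \<le> nrm A (x \<oplus> of_real t \<odot> \<one>) - t"
  obtains \<phi> where "state \<phi>" "h \<le> Re (\<phi> x)"
proof -
  define p where "p = lower (nrm A) \<one>"
  have p: "sublinear p" unfolding p_def by (rule sublinear_lower) (auto simp: sublinear_nrm)
  obtain f where add: "\<And>x y. x \<in> carrier A \<Longrightarrow> y \<in> carrier A \<Longrightarrow> f (x \<oplus> y) = f x + f y"
    and smult: "\<And>t x. x \<in> carrier A \<Longrightarrow> f (of_real t \<odot> x) = t * f x"
    and le: "\<And>y. y \<in> carrier A \<Longrightarrow> f y \<le> lower p x y"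
    using exists_linear_le[OF sublinear_lower[OF p x]] by blast
  have uminus: "f (\<ominus> y) = - f y" if "y \<in> carrier A" for y
    using smult[of y "- 1"] that by (simp add: minus_one_smult)
  have fx: "p x \<le> f x"
    using le[of "\<ominus> x"] lower_uminus[OF p x] uminus[of x] x by simp
  have f_p: "f y \<le> p y" if "y \<in> carrier A" for y
    using le[OF that] lower_le_self[OF p x that] by simp
  have f_nrm: "f y \<le> nrm A y" if "y \<in> carrier A" for y
    using f_p[OF that] lower_le_self[OF sublinear_nrm one_closed that] by (simp add: p_def)
  have "1 \<le> f \<one>"
    using f_p[of "\<ominus> \<one>"] lower_uminus[OF sublinear_nrm one_closed] uminus[of \<one>]
    by (simp add: p_def nrm_one)
  then have f1: "f \<one> = 1" using f_nrm[of \<one>] by (simp add: nrm_one)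
  have "h \<le> p x"
    unfolding p_def using h by (intro lower_greatest) (auto simp: sublinear_nrm nrm_one)
  define \<phi> where "\<phi> = (\<lambda>y. Complex (f y) (- f (\<i> \<odot> y)))"
  have \<phi>_add: "\<phi> (y \<oplus> z) = \<phi> y + \<phi> z" if "y \<in> carrier A" "z \<in> carrier A" for y z
    using that by (simp add: \<phi>_def complex_eq_iff add smult_add_right smult_in)
  have \<phi>_smult: "\<phi> (c \<odot> y) = c * \<phi> y" if y: "y \<in> carrier A" for c y
  proof -
    have c: "c \<odot> y = of_real (Re c) \<odot> y \<oplus> of_real (Im c) \<odot> (\<i> \<odot> y)"
      using y by (simp add: smult_smult mult.commute flip: smult_add complex_eq)
    have ic: "\<i> \<odot> (c \<odot> y) = of_real (Re c) \<odot> (\<i> \<odot> y) \<oplus> of_real (- Im c) \<odot> y"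
    proof -
      have "\<i> * c = of_real (Re c) * \<i> + of_real (- Im c)" by (simp add: complex_eq_iff)
      then show ?thesis using y by (simp add: smult_smult del: of_real_minus flip: smult_add)
    qed
    show ?thesis
      unfolding \<phi>_def ic using y by (simp add: c complex_eq_iff add smult smult_in del: of_real_minus)
  qed
  have \<phi>_le: "cmod (\<phi> y) \<le> nrm A y" if y: "y \<in> carrier A" for y
  proof (cases "\<phi> y = 0")
    case True
    then show ?thesis using nrm_nonneg y by simp
  next
    case False
    \<comment> \<open>Rotating by this phase makes the value real and nonnegative, so the bound on
      the real part \<open>f\<close> controls the modulus.\<close>
    define c where "c = cnj (\<phi> y) / cmod (\<phi> y)"
    have c: "cmod c = 1" using False by (simp add: c_def norm_divide)
    have "c * \<phi> y = cmod (\<phi> y)"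
      using False complex_norm_square[of "\<phi> y"] by (simp add: c_def power2_eq_square mult.commute field_simps)
    then have "cmod (\<phi> y) = Re (\<phi> (c \<odot> y))" using y by (simp add: \<phi>_smult)
    also have "\<dots> \<le> nrm A (c \<odot> y)" using f_nrm[of "c \<odot> y"] y by (simp add: \<phi>_def smult_in)
    finally show ?thesis using c y by (simp add: nrm_smult)
  qed
  have "Re (\<phi> \<one>) = 1" by (simp add: \<phi>_def f1)
  moreover have "cmod (\<phi> \<one>) \<le> 1" using \<phi>_le[of \<one>] by (simp add: nrm_one)
  then have "(cmod (\<phi> \<one>))\<^sup>2 \<le> 1" by (simp add: power_le_one)
  ultimately have "\<phi> \<one> = 1" by (simp add: cmod_power2 complex_eq_iff)
  then have "state \<phi>" using \<phi>_add \<phi>_smult \<phi>_le by (simp add: state_def)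
  moreover have "h \<le> Re (\<phi> x)" using fx \<open>h \<le> p x\<close> by (simp add: \<phi>_def)
  ultimately show ?thesis by (rule that)
qed

lemma exists_state: "\<exists>\<phi>. state \<phi>"
proof -
  have "- 1 \<le> nrm A (\<one> \<oplus> of_real t \<odot> \<one>) - t" if "0 \<le> t" for t
    using nrm_diff[of "of_real t \<odot> \<one>" \<one>] that
    by (simp add: smult_in nrm_smult nrm_one a_comm)
  then obtain \<phi> where "state \<phi>"
    using exists_state_Re_ge[OF one_closed, of "- 1"] by metis
  then show ?thesis by blast
qed

text \<open>Contrapositive of \<open>exists_state_Re_ge\<close>: some shift \<open>T\<close>
  satisfies the bound, and passing from \<open>T\<close> to a larger \<open>t\<close> adds at most
  \<open>t - T\<close> to the norm.\<close>

lemma nrm_shift_le: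
  assumes x: "x \<in> carrier A" and h: "\<forall>\<phi>. state \<phi> \<longrightarrow> Re (\<phi> x) < h"
  obtains T where "0 \<le> T" "\<And>t. T \<le> t \<Longrightarrow> nrm A (x \<oplus> of_real t \<odot> \<one>) \<le> t + h"
proof -
  have "\<exists>T\<ge>0. nrm A (x \<oplus> of_real T \<odot> \<one>) - T < h"
  proof (rule ccontr)
    assume "\<not> ?thesis"
    then have "h \<le> nrm A (x \<oplus> of_real t \<odot> \<one>) - t" if "0 \<le> t" for t
      using that by (simp add: not_less)
    then obtain \<phi> where "state \<phi>" "h \<le> Re (\<phi> x)"
      by (rule exists_state_Re_ge[OF x])
    then show False using h by (simp add: not_less[symmetric])
  qed
  then obtain T where T: "0 \<le> T" "nrm A (x \<oplus> of_real T \<odot> \<one>) - T < h" by blast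
  have "nrm A (x \<oplus> of_real t \<odot> \<one>) \<le> t + h" if t: "T \<le> t" for t
  proof -
    have "of_real t \<odot> \<one> = of_real T \<odot> \<one> \<oplus> of_real (t - T) \<odot> \<one>"
      by (simp flip: smult_add)
    then have "x \<oplus> of_real t \<odot> \<one> = (x \<oplus> of_real T \<odot> \<one>) \<oplus> of_real (t - T) \<odot> \<one>"
      using x by (simp add: a_assoc smult_in del: of_real_diff)
    then have "nrm A (x \<oplus> of_real t \<odot> \<one>) \<le> nrm A (x \<oplus> of_real T \<odot> \<one>) + nrm A (of_real (t - T) \<odot> \<one>)"
      using x nrm_triangle[of "x \<oplus> of_real T \<odot> \<one>" "of_real (t - T) \<odot> \<one>"]
      by (simp add: smult_in del: of_real_diff)
    then show ?thesis using T t by (simp add: nrm_smult nrm_one del: of_real_diff)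
  qed
  with T(1) show ?thesis by (rule that)
qed

section \<open>Powers of \<open>1 + w b\<close> and numerical ranges in a half plane\<close>

lemma nrm_pow_le: "x \<in> carrier A \<Longrightarrow> nrm A (x [^] (n::nat)) \<le> nrm A x ^ n"
proof (induction n)
  case (Suc n)
  have "nrm A (x [^] Suc n) \<le> nrm A (x [^] n) * nrm A x"
    using Suc.prems nrm_mult[of "x [^] n" x] by simp
  also have "\<dots> \<le> nrm A x ^ n * nrm A x"
    using Suc by (intro mult_right_mono) (auto simp: nrm_nonneg)
  finally show ?case by (simp add: mult.commute)
qed (simp add: nrm_one)

text \<open>Interpolation at the two square roots \<open>\<delta>\<close> and
  \<open>- \<delta>\<close>: the coefficients are the even and odd parts of
  \<open>(1 + w * \<delta>) ^ n\<close> in \<open>\<delta>\<close>, the odd one divided by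
  \<open>\<delta>\<close>.\<close>

lemma one_plus_pow:
  assumes b: "b \<in> carrier A" "b \<otimes> b = \<delta>\<^sup>2 \<odot> \<one>" and "\<delta> \<noteq> 0"
  shows "lin b 1 w [^] (n::nat) = lin b (((1 + w * \<delta>) ^ n + (1 - w * \<delta>) ^ n) / 2)
    (((1 + w * \<delta>) ^ n - (1 - w * \<delta>) ^ n) / (2 * \<delta>))"
proof (induction n)
  case 0
  then show ?case using b by (simp add: lin_def one_smult zero_smult)
next
  case (Suc n)
  show ?case
    unfolding nat_pow_Suc Suc.IH lin_mult[OF b]
    by (rule arg_cong2[where f = "lin b"]) (use assms in \<open>simp_all add: field_simps power2_eq_square\<close>)
qed

text \<open>The binomial expansion stops after its linear term.\<close>

lemma one_plus_pow_nilpotent: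
  assumes b: "b \<in> carrier A" "b \<otimes> b = \<zero>"
  shows "lin b 1 w [^] (n::nat) = lin b 1 (of_nat n * w)"
proof (induction n)
  case 0
  then show ?case using b by (simp add: lin_def one_smult zero_smult)
next
  case (Suc n)
  have "b \<otimes> b = 0 \<odot> \<one>" using b by (simp add: zero_smult)
  from lin_mult[OF b(1) this] show ?case
    unfolding nat_pow_Suc Suc.IH by (simp add: algebra_simps)
qed

text \<open>
  The coefficients of \<open>exp (z b) = cosh (z \<delta>) 1 + sinh (z \<delta>) / \<delta> b\<close> arise as limits
  of those of \<open>(1 + z b / n) ^ n\<close>, whose norm is controlled by the half plane.
\<close>

lemma half_plane_pow_bound:
  assumes b: "b \<in> carrier A" and h: "\<forall>\<phi>. state \<phi> \<longrightarrow> Re (z * \<phi> b) < h"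
  shows "\<forall>\<^sub>F n in sequentially. nrm A (lin b 1 (z / of_nat n) [^] n) \<le> exp h"
proof -
  have zb: "z \<odot> b \<in> carrier A" using b by (simp add: smult_in)
  have "\<forall>\<phi>. state \<phi> \<longrightarrow> Re (\<phi> (z \<odot> b)) < h"
    using h b by (simp add: state_def)
  from nrm_shift_le[OF zb this] obtain T where T: "0 \<le> T"
    "\<And>t. T \<le> t \<Longrightarrow> nrm A (z \<odot> b \<oplus> of_real t \<odot> \<one>) \<le> t + h" by blast
  show ?thesis
    using eventually_ge_at_top[of "nat \<lceil>T\<rceil>"] eventually_gt_at_top[of 0]
  proof eventually_elim
    case (elim n)
    have le: "nrm A (z \<odot> b \<oplus> of_real (real n) \<odot> \<one>) \<le> real n + h"
      using T(2)[of "real n"] elim by simp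
    \<comment> \<open>With the factor \<open>1 / n\<close> pulled out, this is the shift of
      \<open>z \<odot> b\<close> by \<open>t = n\<close>, to which the half plane estimate
      applies.\<close>
    have "lin b 1 (z / of_nat n) = (1 / of_nat n) \<odot> (z \<odot> b \<oplus> of_real (real n) \<odot> \<one>)"
      using elim b by (simp add: lin_def smult_add_right smult_smult smult_in one_smult a_comm)
    then have "nrm A (lin b 1 (z / of_nat n)) = (1 / real n) * nrm A (z \<odot> b \<oplus> of_real (real n) \<odot> \<one>)"
      using zb by (simp add: nrm_smult smult_in norm_divide)
    also have "\<dots> \<le> (1 / real n) * (real n + h)" using le by (intro mult_left_mono) auto
    also have "\<dots> = 1 + h / real n" using elim by (simp add: field_simps)
    finally have 1: "nrm A (lin b 1 (z / of_nat n)) \<le> 1 + h / real n" .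
    have "0 \<le> real n + h"
      using le nrm_nonneg[of "z \<odot> b \<oplus> of_real (real n) \<odot> \<one>"] zb by (simp add: smult_in)
    have "nrm A (lin b 1 (z / of_nat n) [^] n) \<le> nrm A (lin b 1 (z / of_nat n)) ^ n"
      using b by (intro nrm_pow_le) auto
    also have "\<dots> \<le> (1 + h / real n) ^ n"
      using 1 b by (intro power_mono) (auto simp: nrm_nonneg)
    also have "\<dots> \<le> exp h"
      using \<open>0 \<le> real n + h\<close> elim by (intro exp_ge_one_plus_x_over_n_power_n) auto
    finally show ?case .
  qed
qed

text \<open>The reverse triangle inequality is applied to the powers before \<open>n\<close> tends
  to infinity. Only complex coefficients pass to the limit, so no exponential has to be formed in
  the algebra.\<close>

lemma half_plane_bound:
  assumes b: "b \<in> carrier A" "b \<otimes> b = \<delta>\<^sup>2 \<odot> \<one>" and "\<delta> \<noteq> 0"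
    and h: "\<forall>\<phi>. state \<phi> \<longrightarrow> Re (z * \<phi> b) < h"
  shows "cmod (sinh (z * \<delta>) / \<delta>) * nrm A b - cmod (cosh (z * \<delta>)) \<le> exp h"
proof (rule tendsto_upperbound)
  let ?p = "\<lambda>n. (1 + z * \<delta> / of_nat n) ^ n" and ?m = "\<lambda>n. (1 + (- (z * \<delta>)) / of_nat n) ^ n"
  have "(\<lambda>n. cmod ((?p n - ?m n) / (2 * \<delta>)) * nrm A b - cmod ((?p n + ?m n) / 2))
      \<longlonglongrightarrow> cmod ((exp (z * \<delta>) - exp (- (z * \<delta>))) / (2 * \<delta>)) * nrm A b - cmod ((exp (z * \<delta>) + exp (- (z * \<delta>))) / 2)"
    using \<open>\<delta> \<noteq> 0\<close> by (intro tendsto_intros complex_exp_limit) auto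
  then show "(\<lambda>n. cmod ((?p n - ?m n) / (2 * \<delta>)) * nrm A b - cmod ((?p n + ?m n) / 2))
      \<longlonglongrightarrow> cmod (sinh (z * \<delta>) / \<delta>) * nrm A b - cmod (cosh (z * \<delta>))"
    by (simp add: sinh_field_def cosh_field_def)
  show "\<forall>\<^sub>F n in sequentially. cmod ((?p n - ?m n) / (2 * \<delta>)) * nrm A b - cmod ((?p n + ?m n) / 2) \<le> exp h"
    using half_plane_pow_bound[OF b(1) h]
  proof eventually_elim
    case (elim n)
    have "cmod ((?p n - ?m n) / (2 * \<delta>)) * nrm A b - cmod ((?p n + ?m n) / 2)
        \<le> nrm A (lin b 1 (z / of_nat n) [^] n)"
    proof -
      have e: "1 + z * \<delta> / of_nat n = 1 + z / of_nat n * \<delta>" "1 + (- (z * \<delta>)) / of_nat n = 1 - z / of_nat n * \<delta>"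
        by simp_all
      show ?thesis
        unfolding one_plus_pow[OF b \<open>\<delta> \<noteq> 0\<close>] e by (rule nrm_lin_ge[OF b(1)])
    qed
    with elim show ?case by simp
  qed
qed simp

text \<open>A single large \<open>n\<close> suffices, because the coefficient
  \<open>n * (z / n)\<close> does not depend on it.\<close>

lemma half_plane_bound_nilpotent:
  assumes b: "b \<in> carrier A" "b \<otimes> b = \<zero>"
    and h: "\<forall>\<phi>. state \<phi> \<longrightarrow> Re (z * \<phi> b) < h"
  shows "cmod z * nrm A b - 1 \<le> exp h"
proof -
  obtain n where n: "0 < n" "nrm A (lin b 1 (z / of_nat n) [^] n) \<le> exp h"
    using eventually_happens'[OF _ eventually_conj[OF eventually_gt_at_top[of 0] half_plane_pow_bound[OF b(1) h]]]
    by auto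
  then show ?thesis
    using nrm_lin_ge[OF b(1), of z 1] by (simp add: one_plus_pow_nilpotent[OF b])
qed

section \<open>Points in the closure of the numerical range\<close>

lemma separate_from_states:
  assumes b: "b \<in> carrier A" and w: "w \<notin> closure {\<phi> b |\<phi>. state \<phi>}"
  obtains u \<beta> where "\<forall>\<phi>. state \<phi> \<longrightarrow> Re (u * \<phi> b) < \<beta>" "\<beta> < Re (u * w)"
proof -
  \<comment> \<open>Convex combinations of states are states, so a point outside the closure can be
    separated by a line; multiplying by \<open>- cnj a\<close> expresses that line through real
    parts.\<close>
  have "convex {\<phi> b |\<phi>. state \<phi>}"
  proof (rule convexI)
    fix x y and s t :: real
    assume st: "0 \<le> s" "0 \<le> t" "s + t = 1"
      and "x \<in> {\<phi> b |\<phi>. state \<phi>}" "y \<in> {\<phi> b |\<phi>. state \<phi>}"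
    then obtain \<phi> \<psi> where xy: "x = \<phi> b" "y = \<psi> b" "state \<phi>" "state \<psi>" by blast
    have "cmod (of_real s * \<phi> v + of_real t * \<psi> v) \<le> nrm A v" if v: "v \<in> carrier A" for v
    proof -
      have "cmod (of_real s * \<phi> v + of_real t * \<psi> v) \<le> s * cmod (\<phi> v) + t * cmod (\<psi> v)"
        by (rule order.trans[OF norm_triangle_ineq]) (use st in \<open>simp add: norm_mult\<close>)
      also have "\<dots> \<le> s * nrm A v + t * nrm A v"
        using xy v st by (intro add_mono mult_left_mono) (auto simp: state_def)
      finally show ?thesis using st by (simp flip: distrib_right)
    qed
    moreover have "of_real s + of_real t = (1 :: complex)" using st by (simp flip: of_real_add)
    moreover have "of_real s * (\<phi> v + \<phi> w) + of_real t * (\<psi> v + \<psi> w)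
        = of_real s * \<phi> v + of_real t * \<psi> v + (of_real s * \<phi> w + of_real t * \<psi> w)"
      "of_real s * (c * \<phi> v) + of_real t * (c * \<psi> v) = c * (of_real s * \<phi> v + of_real t * \<psi> v)" for c v w
      by (simp_all add: algebra_simps)
    ultimately have "state (\<lambda>v. of_real s * \<phi> v + of_real t * \<psi> v)"
      using xy(3,4) unfolding state_def by simp
    then show "s *\<^sub>R x + t *\<^sub>R y \<in> {\<phi> b |\<phi>. state \<phi>}"
      using xy by (auto simp: scaleR_conv_of_real)
  qed
  then obtain a \<beta> where a: "inner a w < \<beta>" "\<forall>x\<in>closure {\<phi> b |\<phi>. state \<phi>}. inner a x > \<beta>"
    using separating_hyperplane_closed_point[OF convex_closure closed_closure w] by blast
  have re: "Re (- cnj a * x) = - inner a x" for x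
    by (simp add: inner_complex_def)
  show ?thesis
  proof (rule that[of "- cnj a" "- \<beta>"])
    show "\<forall>\<phi>. state \<phi> \<longrightarrow> Re (- cnj a * \<phi> b) < - \<beta>"
    proof (intro allI impI)
      fix \<phi> assume "state \<phi>"
      then have "\<phi> b \<in> {\<phi> b |\<phi>. state \<phi>}" by (intro CollectI exI conjI) (rule refl)
      then have "\<phi> b \<in> closure {\<phi> b |\<phi>. state \<phi>}" by (rule subsetD[OF closure_subset])
      with a(2) show "Re (- cnj a * \<phi> b) < - \<beta>" unfolding re by simp
    qed
    show "- \<beta> < Re (- cnj a * w)" using a(1) unfolding re by simp
  qed
qed

text \<open>A separating half plane bounds the norm of \<open>u b + T\<close> by
  \<open>T + \<beta>\<close>. Its eigenvalue \<open>u * \<delta> + T\<close> has modulus at most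
  that norm, yet its real part exceeds \<open>T + \<beta>\<close>.\<close>

lemma eigenvalue_in_closure_states:
  assumes b: "b \<in> carrier A" and y: "y \<in> carrier A" "y \<noteq> \<zero>" "b \<otimes> y = \<delta> \<odot> y"
  shows "\<delta> \<in> closure {\<phi> b |\<phi>. state \<phi>}"
proof (rule ccontr)
  assume w: "\<delta> \<notin> closure {\<phi> b |\<phi>. state \<phi>}"
  obtain u \<beta> where u: "\<forall>\<phi>. state \<phi> \<longrightarrow> Re (u * \<phi> b) < \<beta>" "\<beta> < Re (u * \<delta>)"
    by (rule separate_from_states[OF b w])
  have ub: "u \<odot> b \<in> carrier A" using b by (simp add: smult_in)
  have "\<forall>\<phi>. state \<phi> \<longrightarrow> Re (\<phi> (u \<odot> b)) < \<beta>"
    using u(1) b by (simp add: state_def)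
  from nrm_shift_le[OF ub this] obtain T where T: "0 \<le> T"
    "nrm A (u \<odot> b \<oplus> of_real T \<odot> \<one>) \<le> T + \<beta>" by (metis order_refl)
  have "(u \<odot> b \<oplus> of_real T \<odot> \<one>) \<otimes> y = (u * \<delta> + of_real T) \<odot> y"
    using b y by (simp add: l_distr smult_mult_left smult_in smult_smult smult_add)
  then have "cmod (u * \<delta> + of_real T) * nrm A y \<le> nrm A (u \<odot> b \<oplus> of_real T \<odot> \<one>) * nrm A y"
    using nrm_mult[of "u \<odot> b \<oplus> of_real T \<odot> \<one>" y] ub y(1) by (simp add: nrm_smult smult_in)
  moreover have "0 < nrm A y" using y nrm_nonneg[of y] nrm_eq_0_iff[of y] by linarith
  ultimately have "cmod (u * \<delta> + of_real T) \<le> T + \<beta>" using T by simp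
  moreover have "Re (u * \<delta>) + T \<le> cmod (u * \<delta> + of_real T)"
    using complex_Re_le_cmod[of "u * \<delta> + of_real T"] by simp
  ultimately show False using u(2) by simp
qed

text \<open>A separating direction is rescaled to \<open>z\<close> with
  \<open>cmod z = 1 / r\<close>, so that the half plane becomes
  \<open>Re (z * \<phi> b) < 1\<close>. The resulting bound on the norm of \<open>b\<close>
  contradicts \<open>cmod_sinh_dominates\<close> at \<open>z * \<delta>\<close>, a point of the unit
  disc.\<close>

lemma disc_in_closure_states:
  assumes b: "b \<in> carrier A" "b \<otimes> b = \<delta>\<^sup>2 \<odot> \<one>"
    and r: "nrm A b = (2 * exp 1 - 1) * r" "cmod \<delta> < r" and w: "cmod w \<le> r"
  shows "w \<in> closure {\<phi> b |\<phi>. state \<phi>}"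
proof (rule ccontr)
  assume w': "w \<notin> closure {\<phi> b |\<phi>. state \<phi>}"
  obtain u \<beta> where u: "\<forall>\<phi>. state \<phi> \<longrightarrow> Re (u * \<phi> b) < \<beta>" "\<beta> < Re (u * w)"
    by (rule separate_from_states[OF b(1) w'])
  have r0: "0 < r" using r(2) by (smt (verit) norm_ge_zero)
  obtain \<psi> where \<psi>: "state \<psi>" using exists_state by (rule exE)
  then have "Re (u * \<psi> b) < \<beta>" using u(1) by simp
  \<comment> \<open>For \<open>u = 0\<close> the existence of a state would give both
    \<open>0 < \<beta>\<close> and \<open>\<beta> < 0\<close>.\<close>
  then have u0: "u \<noteq> 0" using u(2) by auto
  have "Re (u * w) \<le> cmod u * r"
    using complex_Re_le_cmod[of "u * w"] w mult_left_mono[OF w norm_ge_zero[of u]]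
    by (simp add: norm_mult)
  then have \<beta>: "\<beta> < cmod u * r" using u(2) by simp
  define z where "z = u / of_real (cmod u * r)"
  have z: "cmod z = 1 / r" using u0 r0 by (simp add: z_def norm_divide norm_mult)
  have bound: "\<forall>\<phi>. state \<phi> \<longrightarrow> Re (z * \<phi> b) < 1"
  proof (intro allI impI)
    fix \<phi> assume \<phi>: "state \<phi>"
    have "z * \<phi> b = u * \<phi> b / of_real (cmod u * r)" by (simp add: z_def)
    then have "Re (z * \<phi> b) = Re (u * \<phi> b) / (cmod u * r)" by (simp only: Re_divide_of_real)
    moreover have "Re (u * \<phi> b) < cmod u * r" using u(1) \<phi> \<beta> by (meson less_trans)
    ultimately show "Re (z * \<phi> b) < 1" using u0 r0 by simp
  qed
  show False
  proof (cases "\<delta> = 0")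
    case True
    then have "cmod z * nrm A b - 1 \<le> exp 1"
      using b bound by (intro half_plane_bound_nilpotent) (auto simp: zero_smult)
    \<comment> \<open>The estimate reads \<open>2 * exp 1 - 2 \<le> exp 1\<close>, that is,
      \<open>exp 1 \<le> 2\<close>.\<close>
    then show False using r r0 z exp_one_bounds by simp
  next
    case False
    have "cmod (sinh (z * \<delta>) / \<delta>) * nrm A b - cmod (cosh (z * \<delta>)) \<le> exp 1"
      using b False bound by (intro half_plane_bound)
    then have "cmod (sinh (z * \<delta>)) / cmod \<delta> * ((2 * exp 1 - 1) * r) \<le> exp 1 + cmod (cosh (z * \<delta>))"
      by (simp add: r(1) norm_divide)
    then have "cmod (z * \<delta>) * (cmod (sinh (z * \<delta>)) / cmod \<delta> * ((2 * exp 1 - 1) * r))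
        \<le> cmod (z * \<delta>) * (exp 1 + cmod (cosh (z * \<delta>)))"
      by (rule mult_left_mono) simp
    moreover have "cmod (z * \<delta>) = cmod \<delta> / r" by (simp add: norm_mult z)
    then have "cmod (z * \<delta>) * (cmod (sinh (z * \<delta>)) / cmod \<delta> * ((2 * exp 1 - 1) * r)) = (2 * exp 1 - 1) * cmod (sinh (z * \<delta>))"
      using False r0 by simp
    ultimately have "(2 * exp 1 - 1) * cmod (sinh (z * \<delta>)) \<le> cmod (z * \<delta>) * (exp 1 + cmod (cosh (z * \<delta>)))"
      by simp
    moreover have "cmod (z * \<delta>) \<le> 1" "z * \<delta> \<noteq> 0"
      using r r0 z False by (auto simp: norm_mult)
    ultimately show False using cmod_sinh_dominates[of "z * \<delta>"] by simp
  qed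
qed

subsection \<open>Polynomials in an element\<close>

text \<open>Zero coefficients beyond the degree allow a common summation range for several
  polynomials.\<close>

lemma alg_eval_eq:
  assumes a: "a \<in> carrier A" and "degree p \<le> n"
  shows "alg_eval A p a = (\<Oplus> i \<in> {..n}. coeff p i \<odot> (a [^] i))"
  using assms(2)
proof (induction rule: dec_induct)
  case (step n)
  have f: "(\<lambda>i. coeff p i \<odot> (a [^] i)) \<in> UNIV \<rightarrow> carrier A" using a by (simp add: smult_in)
  have "(\<Oplus> i \<in> {..Suc n}. coeff p i \<odot> (a [^] i)) = coeff p (Suc n) \<odot> (a [^] Suc n) \<oplus> (\<Oplus> i \<in> {..n}. coeff p i \<odot> (a [^] i))"
    using f by (intro finsum_Suc) auto
  moreover have "coeff p (Suc n) = 0" using step by (intro coeff_eq_0) simp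
  moreover have "(\<Oplus> i \<in> {..n}. coeff p i \<odot> (a [^] i)) \<in> carrier A"
    using f by (intro finsum_closed) auto
  ultimately show ?case using step.IH a by (simp add: zero_smult)
qed (simp add: alg_eval_def)

lemma alg_eval_closed [simp]: "a \<in> carrier A \<Longrightarrow> alg_eval A p a \<in> carrier A"
  unfolding alg_eval_def by (intro finsum_closed) (auto simp: smult_in)

text \<open>Horner's rule, which opens evaluation to structural induction on the polynomial.\<close>

lemma alg_eval_pCons:
  assumes a: "a \<in> carrier A"
  shows "alg_eval A (pCons k p) a = k \<odot> \<one> \<oplus> a \<otimes> alg_eval A p a"
proof -
  let ?f = "\<lambda>i. coeff (pCons k p) i \<odot> (a [^] i)"
  have "alg_eval A (pCons k p) a = (\<Oplus> i \<in> {..Suc (degree p)}. ?f i)"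
    using a by (intro alg_eval_eq) (auto simp: degree_pCons_le)
  also have "\<dots> = (\<Oplus> i \<in> {..degree p}. ?f (Suc i)) \<oplus> ?f 0"
    using a by (intro finsum_Suc2) (auto simp: smult_in)
  also have "(\<Oplus> i \<in> {..degree p}. ?f (Suc i)) = (\<Oplus> i \<in> {..degree p}. a \<otimes> (coeff p i \<odot> (a [^] i)))"
  proof -
    have "a [^] i \<otimes> a = a \<otimes> a [^] i" for i :: nat using a by (metis nat_pow_Suc nat_pow_Suc2)
    then show ?thesis using a by (intro finsum_cong') (auto simp: smult_in smult_mult_right)
  qed
  also have "\<dots> = a \<otimes> alg_eval A p a"
    unfolding alg_eval_def using a by (intro finsum_rdistr[symmetric]) (auto simp: smult_in)
  finally show ?thesis using a by (simp add: a_comm smult_in)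
qed

lemma alg_eval_0 [simp]: "a \<in> carrier A \<Longrightarrow> alg_eval A 0 a = \<zero>"
  by (simp add: alg_eval_def zero_smult)

lemma alg_eval_add:
  assumes a: "a \<in> carrier A"
  shows "alg_eval A (p + q) a = alg_eval A p a \<oplus> alg_eval A q a"
proof -
  let ?n = "max (degree p) (degree q)"
  have "alg_eval A (p + q) a = (\<Oplus> i \<in> {..?n}. coeff p i \<odot> (a [^] i) \<oplus> coeff q i \<odot> (a [^] i))"
    using a alg_eval_eq[OF a degree_add_le_max[of p q]] by (simp add: smult_add)
  also have "\<dots> = (\<Oplus> i \<in> {..?n}. coeff p i \<odot> (a [^] i)) \<oplus> (\<Oplus> i \<in> {..?n}. coeff q i \<odot> (a [^] i))"
    using a by (intro finsum_addf) (auto simp: smult_in)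
  finally show ?thesis using alg_eval_eq[OF a, of p ?n] alg_eval_eq[OF a, of q ?n] by simp
qed

lemma alg_eval_smult:
  assumes a: "a \<in> carrier A"
  shows "alg_eval A (Polynomial.smult c p) a = c \<odot> alg_eval A p a"
proof -
  have "alg_eval A (Polynomial.smult c p) a = (\<Oplus> i \<in> {..degree p}. c \<odot> (coeff p i \<odot> (a [^] i)))"
    using a alg_eval_eq[OF a degree_smult_le[of c p]] by (simp add: smult_smult)
  also have "\<dots> = c \<odot> alg_eval A p a"
    unfolding alg_eval_def using a by (intro finsum_smult_ldistr[symmetric]) (auto simp: smult_in)
  finally show ?thesis .
qed

text \<open>Justifies the definite description. An annihilating polynomial of least degree can be
  made monic; the difference of two such monic polynomials has smaller degree, hence
  vanishes.\<close>

lemma minimal_poly_properties: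
  assumes a: "a \<in> carrier A" and "algebraic_elem A a"
  shows "lead_coeff (minimal_poly A a) = 1" "alg_eval A (minimal_poly A a) a = \<zero>"
    "\<And>q. q \<noteq> 0 \<Longrightarrow> alg_eval A q a = \<zero> \<Longrightarrow> degree (minimal_poly A a) \<le> degree q"
proof -
  define P where "P = (\<lambda>p. lead_coeff p = 1 \<and> alg_eval A p a = \<zero> \<and>
     (\<forall>q. q \<noteq> 0 \<and> alg_eval A q a = \<zero> \<longrightarrow> degree p \<le> degree q))"
  obtain p where p: "p \<noteq> 0" "alg_eval A p a = \<zero>" "\<And>q. q \<noteq> 0 \<and> alg_eval A q a = \<zero> \<Longrightarrow> degree p \<le> degree q"
    using assms(2) ex_has_least_nat[of "\<lambda>p. p \<noteq> 0 \<and> alg_eval A p a = \<zero>" _ degree]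
    unfolding algebraic_elem_def by blast
  have "P (Polynomial.smult (inverse (lead_coeff p)) p)"
    using p a by (simp add: P_def alg_eval_smult smult_zero)
  moreover have "p' = q" if "P p'" "P q" for p' q
  proof (rule ccontr)
    assume "p' \<noteq> q"
    have "p' \<noteq> 0" "q \<noteq> 0" using that by (auto simp: P_def)
    then have deg: "degree p' = degree q"
      using that by (intro antisym) (auto simp: P_def)
    let ?d = "p' + Polynomial.smult (- 1) q"
    have "?d \<noteq> 0" using \<open>p' \<noteq> q\<close> by simp
    moreover have "alg_eval A ?d a = \<zero>"
      using that a by (simp add: P_def alg_eval_add alg_eval_smult smult_zero del: Polynomial.smult_minus_left)
    ultimately have "degree p' \<le> degree ?d" using that by (simp add: P_def)
    moreover have "degree ?d \<le> degree p'" using deg by (intro degree_add_le) auto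
    moreover have "coeff ?d (degree p') = 0" using that deg by (simp add: P_def)
    ultimately show False using \<open>?d \<noteq> 0\<close> by (metis antisym leading_coeff_0_iff)
  qed
  ultimately have "P (THE p. P p)" by (metis theI)
  then have "P (minimal_poly A a)" unfolding minimal_poly_def P_def by simp
  then show "lead_coeff (minimal_poly A a) = 1" "alg_eval A (minimal_poly A a) a = \<zero>"
    "\<And>q. q \<noteq> 0 \<Longrightarrow> alg_eval A q a = \<zero> \<Longrightarrow> degree (minimal_poly A a) \<le> degree q"
    by (auto simp: P_def)
qed

text \<open>\<open>E\<close> and \<open>Q\<close> are built by the same recursion on both sides:
  multiplying by \<open>c + z\<close> and adding \<open>k\<close> turns the pair into
  \<open>k + c E + w Q\<close> and \<open>E + c Q\<close> with \<open>w = z\<^sup>2\<close>, and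
  multiplication by \<open>lin b c 1\<close> acts alike with \<open>w = d\<close>.\<close>

lemma alg_eval_even_odd:
  assumes b: "b \<in> carrier A" "b \<otimes> b = d \<odot> \<one>"
  obtains E Q where "\<And>z. poly p (c + z) = poly E (z\<^sup>2) + z * poly Q (z\<^sup>2)"
    "alg_eval A p (lin b c 1) = lin b (poly E d) (poly Q d)"
proof -
  have "\<exists>E Q. (\<forall>z. poly p (c + z) = poly E (z\<^sup>2) + z * poly Q (z\<^sup>2)) \<and>
    alg_eval A p (lin b c 1) = lin b (poly E d) (poly Q d)"
  proof (induction p)
    case 0
    then show ?case using b by (intro exI[of _ 0]) (simp add: lin_def zero_smult)
  next
    case (pCons k p)
    then obtain E Q where EQ: "\<And>z. poly p (c + z) = poly E (z\<^sup>2) + z * poly Q (z\<^sup>2)"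
      "alg_eval A p (lin b c 1) = lin b (poly E d) (poly Q d)" by blast
    have k: "k \<odot> \<one> = lin b k 0" using b by (simp add: lin_def zero_smult smult_in)
    show ?case
    proof (intro exI conjI allI)
      show "poly (pCons k p) (c + z) = poly (pCons k Q + Polynomial.smult c E) (z\<^sup>2) + z * poly (E + Polynomial.smult c Q) (z\<^sup>2)" for z
        by (simp add: EQ power2_eq_square algebra_simps)
      show "alg_eval A (pCons k p) (lin b c 1) = lin b (poly (pCons k Q + Polynomial.smult c E) d) (poly (E + Polynomial.smult c Q) d)"
        unfolding alg_eval_pCons[OF lin_closed[OF b(1)]] EQ k lin_mult[OF b] lin_add[OF b(1)]
        by (simp add: algebra_simps)
    qed
  qed
  then show ?thesis using that by blast
qed

text \<open>Completing the square in the minimal polynomial. Degree 0 is impossible because the unit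
  is nonzero; in degree 1 the element is scalar and \<open>b = \<zero>\<close>,
  \<open>\<delta> = 0\<close>, with the unit as eigenvector.\<close>

lemma degree_two_normal_form:
  assumes a: "a \<in> carrier A" "algebraic_elem A a" "algebraic_degree A a \<le> 2"
  obtains b c \<delta> where "b \<in> carrier A" "a = lin b c 1" "b \<otimes> b = \<delta>\<^sup>2 \<odot> \<one>"
    "\<exists>y\<in>carrier A. y \<noteq> \<zero> \<and> b \<otimes> y = \<delta> \<odot> y"
    "\<exists>y\<in>carrier A. y \<noteq> \<zero> \<and> b \<otimes> y = (- \<delta>) \<odot> y"
proof -
  let ?m = "minimal_poly A a"
  note m = minimal_poly_properties[OF a(1,2)]
  have one: "\<one> \<noteq> \<zero>" using nrm_one nrm_zero by fastforce
  have linear: "alg_eval A [:t, 1:] a = t \<odot> \<one> \<oplus> a" for t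
    using a(1) by (simp add: alg_eval_pCons one_smult)
  consider "degree ?m = 0" | "degree ?m = 1" | "degree ?m = 2"
    using a(3) unfolding algebraic_degree_def by linarith
  then show ?thesis
  proof cases
    case 1
    then obtain t where t: "?m = [:t:]" by (rule degree_eq_zeroE)
    then have "t = 1" using m(1) by simp
    then show ?thesis using t m(2) a(1) one by (simp add: alg_eval_pCons one_smult)
  next
    case 2
    then obtain s t where "?m = [:t, s:]" by (metis One_nat_def degree_eq_zeroE degree_pCons_eq_if nat.inject pCons_cases zero_neq_one)
    then have m': "?m = [:t, 1:]" using m(1) 2 by (simp split: if_splits)
    have "t \<odot> \<one> \<oplus> a = \<zero>" using m(2) unfolding m' linear .
    then have "a = \<ominus> (t \<odot> \<one>)" using a(1) by (simp add: smult_in minus_equality a_comm[of "t \<odot> \<one>"])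
    also have "\<dots> = lin \<zero> (- t) 1" by (simp add: lin_def smult_zero smult_smult smult_in flip: minus_one_smult)
    finally have a': "a = lin \<zero> (- t) 1" .
    show ?thesis
      by (rule that[OF zero_closed a', of 0]) (use one in \<open>auto simp: zero_smult intro!: bexI[of _ \<one>]\<close>)
  next
    case 3
    obtain s t v where "?m = [:t, s, v:]"
      using 3 by (metis degree_eq_zeroE degree_pCons_eq_if nat.inject numeral_2_eq_2 pCons_cases zero_neq_numeral)
    then have m': "?m = [:t, s, 1:]" using m(1) 3 by (simp add: numeral_2_eq_2 split: if_splits)
    have quad: "t \<odot> \<one> \<oplus> a \<otimes> (s \<odot> \<one> \<oplus> a) = \<zero>"
      using m(2) a(1) unfolding m' by (simp add: alg_eval_pCons one_smult)
    \<comment> \<open>By minimality no polynomial of degree one annihilates \<open>a\<close>; this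
      keeps the eigenvectors below nonzero.\<close>
    have shift: "t' \<odot> \<one> \<oplus> a \<noteq> \<zero>" for t'
      using m(3)[of "[:t', 1:]"] 3 by (auto simp: linear)
    define b \<delta> where "b = (s / 2) \<odot> \<one> \<oplus> a" and "\<delta> = csqrt (s\<^sup>2 / 4 - t)"
    have b: "b \<in> carrier A" using a(1) by (simp add: b_def smult_in)
    have a': "a = lin b (- s / 2) 1"
    proof -
      have "lin b (- s / 2) 1 = ((- s / 2) \<odot> \<one> \<oplus> (s / 2) \<odot> \<one>) \<oplus> a"
        using a(1) by (simp add: lin_def b_def one_smult smult_in a_assoc)
      also have "(- s / 2) \<odot> \<one> \<oplus> (s / 2) \<odot> \<one> = \<zero>" by (simp flip: smult_add add: zero_smult)
      finally show ?thesis using a(1) by simp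
    qed
    have "a \<otimes> (s \<odot> \<one> \<oplus> a) = s \<odot> a \<oplus> a \<otimes> a"
      using a(1) by (simp add: r_distr smult_mult_right smult_in)
    with quad have q: "t \<odot> \<one> \<oplus> (s \<odot> a \<oplus> a \<otimes> a) = \<zero>" by simp
    have "b \<otimes> b = (s / 2) \<odot> ((s / 2) \<odot> \<one> \<oplus> a) \<oplus> ((s / 2) \<odot> a \<oplus> a \<otimes> a)"
      using a(1) by (simp add: b_def l_distr r_distr smult_mult_right smult_mult_left smult_in)
    also have "\<dots> = (s / 2 * (s / 2)) \<odot> \<one> \<oplus> (((s / 2) \<odot> a \<oplus> (s / 2) \<odot> a) \<oplus> a \<otimes> a)"
      using a(1) by (simp add: smult_add_right smult_smult smult_in a_assoc)
    also have "(s / 2) \<odot> a \<oplus> (s / 2) \<odot> a = s \<odot> a" using a(1) by (simp flip: smult_add)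
    also have "(s / 2 * (s / 2)) \<odot> \<one> = \<delta>\<^sup>2 \<odot> \<one> \<oplus> t \<odot> \<one>"
    proof -
      have "s / 2 * (s / 2) = \<delta>\<^sup>2 + t" by (simp add: \<delta>_def) (simp add: power2_eq_square)
      then show ?thesis by (simp only: smult_add[OF one_closed])
    qed
    also have "\<delta>\<^sup>2 \<odot> \<one> \<oplus> t \<odot> \<one> \<oplus> (s \<odot> a \<oplus> a \<otimes> a) = \<delta>\<^sup>2 \<odot> \<one>"
      using q a(1) by (simp add: a_assoc smult_in)
    finally have bb: "b \<otimes> b = \<delta>\<^sup>2 \<odot> \<one>" .
    have eigen: "\<exists>y\<in>carrier A. y \<noteq> \<zero> \<and> b \<otimes> y = \<epsilon> \<odot> y" if "\<epsilon>\<^sup>2 = \<delta>\<^sup>2" for \<epsilon>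
    proof (intro bexI conjI)
      \<comment> \<open>The eigenvector is \<open>b + \<epsilon>\<close>, because
        \<open>b (b + \<epsilon>) = \<epsilon>\<^sup>2 + \<epsilon> b\<close>.\<close>
      show "lin b \<epsilon> 1 \<in> carrier A" using b by simp
      have "lin b \<epsilon> 1 = (\<epsilon> + s / 2) \<odot> \<one> \<oplus> a"
        using a(1) by (simp add: lin_def b_def one_smult smult_in smult_add a_assoc)
      then show "lin b \<epsilon> 1 \<noteq> \<zero>" using shift by simp
      have "b = lin b 0 1" using b by (simp add: lin_def zero_smult one_smult)
      then show "b \<otimes> lin b \<epsilon> 1 = \<epsilon> \<odot> lin b \<epsilon> 1"
        using lin_mult[OF b bb, of 0 1 \<epsilon> 1] b that by (simp add: smult_lin power2_eq_square)
    qed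
    show ?thesis by (rule that[OF b a' bb eigen eigen]) auto
  qed
qed

section \<open>The norm estimate for elements of degree at most two\<close>

theorem nrm_alg_eval_le:
  assumes a: "a \<in> carrier A" "algebraic_elem A a" "algebraic_degree A a \<le> 2"
    and M: "\<And>z. z \<in> numerical_range a A \<Longrightarrow> cmod (poly p z) \<le> M"
  shows "nrm A (alg_eval A p a) \<le> sqrt (1 + (2 * exp 1 - 1)\<^sup>2) * M"
proof -
  obtain b c \<delta> where b: "b \<in> carrier A" and ab: "a = lin b c 1" and bb: "b \<otimes> b = \<delta>\<^sup>2 \<odot> \<one>"
    and eigen: "\<exists>y\<in>carrier A. y \<noteq> \<zero> \<and> b \<otimes> y = \<delta> \<odot> y" "\<exists>y\<in>carrier A. y \<noteq> \<zero> \<and> b \<otimes> y = (- \<delta>) \<odot> y"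
    using degree_two_normal_form[OF a] by blast
  obtain E Q where EQ: "\<And>z. poly p (c + z) = poly E (z\<^sup>2) + z * poly Q (z\<^sup>2)"
    and eval: "alg_eval A p a = lin b (poly E (\<delta>\<^sup>2)) (poly Q (\<delta>\<^sup>2))"
    using alg_eval_even_odd[OF b bb, of p c] unfolding ab by metis
  let ?V = "{\<phi> b |\<phi>. state \<phi>}"
  have "?V \<subseteq> {z. cmod (poly p (c + z)) \<le> M}"
  proof clarify
    fix \<phi> assume \<phi>: "state \<phi>"
    then have "\<phi> a = c + \<phi> b"
      using b by (simp add: state_def ab lin_def smult_in)
    moreover have "\<phi> a \<in> numerical_range a A" using \<phi> by (auto simp: numerical_range_eq)
    ultimately show "cmod (poly p (c + \<phi> b)) \<le> M" using M by metis
  qed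
  moreover have "closed {z. cmod (poly p (c + z)) \<le> M}"
    by (intro closed_Collect_le continuous_intros)
  ultimately have closure: "closure ?V \<subseteq> {z. cmod (poly p (c + z)) \<le> M}"
    by (rule closure_minimal)
  have ev: "\<delta> \<in> closure ?V" "- \<delta> \<in> closure ?V"
    using eigen eigenvalue_in_closure_states[OF b] by blast+
  then have M0: "0 \<le> M" using closure by (smt (verit) mem_Collect_eq norm_ge_zero subsetD)
  define K :: real where "K = 2 * exp 1 - 1"
  have K: "0 < K" using exp_one_bounds by (simp add: K_def)
  define r where "r = nrm A b / K"
  have r: "nrm A b = K * r" "0 \<le> r" using K nrm_nonneg[OF b] by (auto simp: r_def)
  \<comment> \<open>The radius \<open>R\<close> is \<open>r\<close> when the closure contains that
    disc and \<open>cmod \<delta>\<close> otherwise. The final estimate is the same for both, since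
    it only increases when \<open>r\<close> is replaced by \<open>R\<close>.\<close>
  have "\<exists>R\<ge>r. (cmod (poly E (\<delta>\<^sup>2)))\<^sup>2 + (R * cmod (poly Q (\<delta>\<^sup>2)))\<^sup>2 \<le> M\<^sup>2"
  proof (cases "cmod \<delta> < r")
    case True
    have "cmod (poly E (z\<^sup>2) + z * poly Q (z\<^sup>2)) \<le> M" if "cmod z \<le> r" for z
      using disc_in_closure_states[OF b bb r(1)[unfolded K_def] True that] closure EQ[of z] by auto
    from even_odd_bound[OF this True] show ?thesis by (auto simp: power_mult_distrib)
  next
    case False
    have "cmod (poly E (\<delta>\<^sup>2) + \<delta> * poly Q (\<delta>\<^sup>2)) \<le> M" "cmod (poly E (\<delta>\<^sup>2) - \<delta> * poly Q (\<delta>\<^sup>2)) \<le> M"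
      using ev closure EQ[of \<delta>] EQ[of "- \<delta>"] by auto
    from parallelogram_bound[OF this] False show ?thesis
      by (intro exI[of _ "cmod \<delta>"]) (simp add: norm_mult)
  qed
  then obtain R where R: "r \<le> R" "(cmod (poly E (\<delta>\<^sup>2)))\<^sup>2 + (R * cmod (poly Q (\<delta>\<^sup>2)))\<^sup>2 \<le> M\<^sup>2" by blast
  have "nrm A (alg_eval A p a) \<le> cmod (poly E (\<delta>\<^sup>2)) + cmod (poly Q (\<delta>\<^sup>2)) * (K * r)"
    unfolding eval using nrm_lin_le[OF b] by (simp only: r(1)[symmetric])
  also have "cmod (poly Q (\<delta>\<^sup>2)) * (K * r) \<le> cmod (poly Q (\<delta>\<^sup>2)) * (K * R)"
    using R K by (intro mult_left_mono) auto
  also have "cmod (poly E (\<delta>\<^sup>2)) + cmod (poly Q (\<delta>\<^sup>2)) * (K * R) \<le> sqrt (1 + K\<^sup>2) * M"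
    using add_mult_le_sqrt[OF R(2) M0, of K] by (simp add: mult_ac)
  finally show ?thesis by (simp add: K_def)
qed

end

subsection \<open>The lower bound\<close>

text \<open>
  The algebra \<open>\<ell>\<^sup>1({1, e})\<close> of the semigroup with \<open>e\<^sup>2 = e\<close>, where \<open>(x, y)\<close> stands for \<open>x 1 + y e\<close>,
  transported along an injection \<open>f\<close>.
\<close>

definition idem_algebra :: "(complex \<times> complex \<Rightarrow> 'a) \<Rightarrow> 'a calgebra" where
  "idem_algebra f = \<lparr>carrier = range f,
     mult = (\<lambda>u v. case (inv_into UNIV f u, inv_into UNIV f v) of ((x, y), (x', y')) \<Rightarrow> f (x * x', x * y' + y * x' + y * y')),
     one = f (1, 0), zero = f (0, 0),
     add = (\<lambda>u v. f (inv_into UNIV f u + inv_into UNIV f v)),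
     smult = (\<lambda>c u. case inv_into UNIV f u of (x, y) \<Rightarrow> f (c * x, c * y)),
     nrm = (\<lambda>u. case inv_into UNIV f u of (x, y) \<Rightarrow> cmod x + cmod y)\<rparr>"

context
  fixes f :: "complex \<times> complex \<Rightarrow> 'a" assumes f: "inj f"
begin

lemma inv_f [simp]: "inv_into UNIV f (f u) = u"
  using f by simp

lemma idem_algebra_simps [simp]:
  "carrier (idem_algebra f) = range f"
  "f (x, y) \<otimes>\<^bsub>idem_algebra f\<^esub> f (x', y') = f (x * x', x * y' + y * x' + y * y')"
  "\<one>\<^bsub>idem_algebra f\<^esub> = f (1, 0)" "\<zero>\<^bsub>idem_algebra f\<^esub> = f (0, 0)"
  "f (x, y) \<oplus>\<^bsub>idem_algebra f\<^esub> f (x', y') = f (x + x', y + y')"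
  "c \<odot>\<^bsub>idem_algebra f\<^esub> f (x, y) = f (c * x, c * y)"
  "nrm (idem_algebra f) (f (x, y)) = cmod x + cmod y"
  by (simp_all add: idem_algebra_def)

lemma abelian_group_idem_algebra: "abelian_group (idem_algebra f)"
proof (rule abelian_groupI)
  fix u assume "u \<in> carrier (idem_algebra f)"
  then obtain x y where u: "u = f (x, y)" by auto
  show "\<exists>v\<in>carrier (idem_algebra f). v \<oplus>\<^bsub>idem_algebra f\<^esub> u = \<zero>\<^bsub>idem_algebra f\<^esub>"
    by (rule bexI[of _ "f (- x, - y)"]) (auto simp: u)
qed (auto simp: add_ac)

lemma ring_idem_algebra: "ring (idem_algebra f)"
proof (rule ringI[OF abelian_group_idem_algebra])
  show "Group.monoid (idem_algebra f)"
    by (rule monoidI) (auto simp: algebra_simps)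
qed (auto simp: algebra_simps)

lemma idem_algebra_minus:
  "f (x, y) \<ominus>\<^bsub>idem_algebra f\<^esub> f (x', y') = f (x - x', y - y')"
proof -
  interpret ring "idem_algebra f" by (rule ring_idem_algebra)
  have "\<ominus>\<^bsub>idem_algebra f\<^esub> f (x', y') = f (- x', - y')"
    by (rule minus_equality) auto
  then show ?thesis by (simp add: minus_eq)
qed

lemma idem_algebra_dist:
  "nrm_dist (idem_algebra f) (f (x, y)) (f (x', y')) = cmod (x - x') + cmod (y - y')"
  by (simp add: nrm_dist_def idem_algebra_minus)

text \<open>Proved directly from the coordinates: the locale that supplies the metric already
  assumes the completeness to be shown next.\<close>

lemma Metric_space_idem_algebra: "Metric_space (range f) (nrm_dist (idem_algebra f))"
proof
  show "0 \<le> nrm_dist (idem_algebra f) u v" for u v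
    by (auto simp: nrm_dist_def idem_algebra_minus)
  show "nrm_dist (idem_algebra f) u v = nrm_dist (idem_algebra f) v u" for u v
    by (auto simp: nrm_dist_def idem_algebra_minus norm_minus_commute)
  show "nrm_dist (idem_algebra f) u v = 0 \<longleftrightarrow> u = v" if "u \<in> range f" "v \<in> range f" for u v
    using that f by (auto simp: idem_algebra_dist add_nonneg_eq_0_iff inj_eq)
  show "nrm_dist (idem_algebra f) u w \<le> nrm_dist (idem_algebra f) u v + nrm_dist (idem_algebra f) v w"
    if uvw: "u \<in> range f" "v \<in> range f" "w \<in> range f" for u v w
  proof -
    from uvw obtain x y x' y' x'' y'' where "u = f (x, y)" "v = f (x', y')" "w = f (x'', y'')" by auto
    then show ?thesis
      using norm_triangle_ineq[of "x - x'" "x' - x''"] norm_triangle_ineq[of "y - y'" "y' - y''"]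
      by (simp add: idem_algebra_dist)
  qed
qed

text \<open>Each coordinate is dominated by the norm, so both are Cauchy sequences of complex
  numbers and converge; their limits give the limit in the algebra.\<close>

lemma mcomplete_idem_algebra: "Metric_space.mcomplete (range f) (nrm_dist (idem_algebra f))"
proof -
  interpret Metric_space "range f" "nrm_dist (idem_algebra f)" by (rule Metric_space_idem_algebra)
  show ?thesis
    unfolding mcomplete_def
  proof (intro allI impI)
    fix \<sigma> assume \<sigma>: "MCauchy \<sigma>"
    define x y where "x = (\<lambda>n. fst (inv_into UNIV f (\<sigma> n)))" and "y = (\<lambda>n. snd (inv_into UNIV f (\<sigma> n)))"
    have xy: "\<sigma> n = f (x n, y n)" for n
    proof -
      have "\<sigma> n \<in> range f" using \<sigma> by (auto simp: MCauchy_def)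
      then show ?thesis by (simp add: x_def y_def f_inv_into_f)
    qed
    have C: "\<exists>N. \<forall>m\<ge>N. \<forall>n\<ge>N. cmod (x m - x n) + cmod (y m - y n) < e" if "0 < e" for e
    proof -
      from \<sigma> that obtain N where "\<And>m n. N \<le> m \<Longrightarrow> N \<le> n \<Longrightarrow> nrm_dist (idem_algebra f) (\<sigma> m) (\<sigma> n) < e"
        unfolding MCauchy_def by metis
      then show ?thesis unfolding xy idem_algebra_dist by (intro exI[of _ N]) simp
    qed
    have "Cauchy x"
    proof (rule CauchyI)
      fix e :: real assume "0 < e"
      from C[OF this] obtain N where N: "\<forall>m\<ge>N. \<forall>n\<ge>N. cmod (x m - x n) + cmod (y m - y n) < e" by blast
      have "cmod (x m - x n) < e" if "N \<le> m" "N \<le> n" for m n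
        using N that norm_ge_zero[of "y m - y n"] by (smt (verit))
      then show "\<exists>M. \<forall>m\<ge>M. \<forall>n\<ge>M. cmod (x m - x n) < e" by blast
    qed
    moreover have "Cauchy y"
    proof (rule CauchyI)
      fix e :: real assume "0 < e"
      from C[OF this] obtain N where N: "\<forall>m\<ge>N. \<forall>n\<ge>N. cmod (x m - x n) + cmod (y m - y n) < e" by blast
      have "cmod (y m - y n) < e" if "N \<le> m" "N \<le> n" for m n
        using N that norm_ge_zero[of "x m - x n"] by (smt (verit))
      then show "\<exists>M. \<forall>m\<ge>M. \<forall>n\<ge>M. cmod (y m - y n) < e" by blast
    qed
    ultimately obtain a b where ab: "x \<longlonglongrightarrow> a" "y \<longlonglongrightarrow> b"
      unfolding Cauchy_convergent_iff convergent_def by blast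
    have "limitin mtopology \<sigma> (f (a, b)) sequentially"
      unfolding limitin_metric
    proof (intro conjI allI impI)
      fix e :: real assume e: "0 < e"
      have "(\<lambda>n. cmod (x n - a) + cmod (y n - b)) \<longlonglongrightarrow> cmod (a - a) + cmod (b - b)"
        by (intro tendsto_intros ab)
      then have "(\<lambda>n. cmod (x n - a) + cmod (y n - b)) \<longlonglongrightarrow> 0" by simp
      from order_tendstoD(2)[OF this e]
      show "\<forall>\<^sub>F n in sequentially. \<sigma> n \<in> range f \<and> nrm_dist (idem_algebra f) (\<sigma> n) (f (a, b)) < e"
        by (simp add: xy idem_algebra_dist)
    qed simp
    then show "\<exists>l. limitin mtopology \<sigma> l sequentially" by blast
  qed
qed

lemma unital_banach_algebra_idem_algebra: "unital_banach_algebra (idem_algebra f)"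
proof (intro unital_banach_algebra.intro unital_banach_algebra_axioms.intro)
  show "module complex_ring (idem_algebra f)"
    by (rule moduleI[OF cring_complex_ring abelian_group_idem_algebra]) (auto simp: algebra_simps)
  show "ring (idem_algebra f)" by (rule ring_idem_algebra)
  show "Metric_space.mcomplete (carrier (idem_algebra f)) (nrm_dist (idem_algebra f))"
    using mcomplete_idem_algebra by simp
  fix u v assume "u \<in> carrier (idem_algebra f)" "v \<in> carrier (idem_algebra f)"
  then obtain x y x' y' where u: "u = f (x, y)" and v: "v = f (x', y')" by auto
  show "nrm (idem_algebra f) (u \<oplus>\<^bsub>idem_algebra f\<^esub> v) \<le> nrm (idem_algebra f) u + nrm (idem_algebra f) v"
    unfolding u v using norm_triangle_ineq[of x x'] norm_triangle_ineq[of y y'] by simp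
  have "cmod (x * y' + y * x' + y * y') \<le> cmod (x * y') + cmod (y * x') + cmod (y * y')"
    by (meson norm_triangle_ineq order.trans add_right_mono)
  then show "nrm (idem_algebra f) (u \<otimes>\<^bsub>idem_algebra f\<^esub> v) \<le> nrm (idem_algebra f) u * nrm (idem_algebra f) v"
    unfolding u v by (simp add: norm_mult algebra_simps)
qed (use f in \<open>auto simp: algebra_simps norm_mult add_nonneg_eq_0_iff inj_eq\<close>)

interpretation A: unital_banach_algebra "idem_algebra f"
  by (rule unital_banach_algebra_idem_algebra)

text \<open>All positive powers of an idempotent agree, so every nonconstant term contributes its
  coefficient to the second coordinate.\<close>

lemma alg_eval_idem: "alg_eval (idem_algebra f) p (f (0, 1)) = f (poly p 0, poly p 1 - poly p 0)"
  by (induction p) (simp_all add: A.alg_eval_pCons algebra_simps)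

lemma idem_algebraic:
  "algebraic_elem (idem_algebra f) (f (0, 1))" "algebraic_degree (idem_algebra f) (f (0, 1)) \<le> 2"
proof -
  have p: "[:0, - 1, 1:] \<noteq> (0 :: complex poly)"
    "alg_eval (idem_algebra f) [:0, - 1, 1:] (f (0, 1)) = \<zero>\<^bsub>idem_algebra f\<^esub>"
    by (simp_all add: alg_eval_idem)
  then show alg: "algebraic_elem (idem_algebra f) (f (0, 1))"
    unfolding algebraic_elem_def by blast
  show "algebraic_degree (idem_algebra f) (f (0, 1)) \<le> 2"
    using A.minimal_poly_properties(3)[OF _ alg p] by (simp add: algebraic_degree_def)
qed

lemma numerical_range_idem:
  "numerical_range (f (0, 1)) (idem_algebra f) \<subseteq> cball 0 1"
  "0 \<in> numerical_range (f (0, 1)) (idem_algebra f)"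
proof -
  have "cmod (\<phi> (f (0, 1))) \<le> 1" if "A.state \<phi>" for \<phi>
  proof -
    have "cmod (\<phi> (f (0, 1))) \<le> nrm (idem_algebra f) (f (0, 1))"
      using that unfolding A.state_def by (metis idem_algebra_simps(1) rangeI)
    then show ?thesis by simp
  qed
  then show "numerical_range (f (0, 1)) (idem_algebra f) \<subseteq> cball 0 1"
    by (auto simp: A.numerical_range_eq)
  \<comment> \<open>The first coordinate is the character that sends the idempotent to 0.\<close>
  have "A.state (\<lambda>u. fst (inv_into UNIV f u))"
    by (auto simp: A.state_def)
  then show "0 \<in> numerical_range (f (0, 1)) (idem_algebra f)"
    unfolding A.numerical_range_eq
    by (intro CollectI exI[of _ "\<lambda>u. fst (inv_into UNIV f u)"]) simp
qed

text \<open>The numerical range lies in the unit disc, so the supremum in the denominator is at most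
  \<open>B\<close>. It is positive because 0 belongs to the numerical range and \<open>p\<close>
  does not vanish there.\<close>

lemma Gamma2_ge:
  fixes p :: "complex poly"
  assumes p: "poly p 0 \<noteq> 0" "\<And>z. cmod z \<le> 1 \<Longrightarrow> cmod (poly p z) \<le> B"
  shows "ereal ((cmod (poly p 0) + cmod (poly p 1 - poly p 0)) / B) \<le> Gamma2 TYPE('a)"
proof -
  let ?V = "numerical_range (f (0, 1)) (idem_algebra f)"
  have B: "0 < B" using p(1) p(2)[of 0] by (smt (verit) norm_zero zero_less_norm_iff)
  have "ereal (cmod (poly p 0)) \<le> sup_on ?V p"
    unfolding sup_on_def by (intro SUP_upper numerical_range_idem(2))
  moreover have "0 < ereal (cmod (poly p 0))" using p(1) by simp
  ultimately have pos: "0 < sup_on ?V p" by (rule less_le_trans[rotated])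
  have le: "sup_on ?V p \<le> ereal B"
    unfolding sup_on_def using numerical_range_idem(1) p(2) by (intro SUP_least) auto
  have "ereal ((cmod (poly p 0) + cmod (poly p 1 - poly p 0)) / B)
      = ereal (cmod (poly p 0) + cmod (poly p 1 - poly p 0)) / ereal B"
    using B by simp
  also have "\<dots> \<le> ereal (cmod (poly p 0) + cmod (poly p 1 - poly p 0)) / sup_on ?V p"
    using le pos B p(1) by (intro ereal_divide_left_mono) (auto simp: ereal_zero_less_0_iff add_pos_nonneg)
  also have "\<dots> = ereal (nrm (idem_algebra f) (alg_eval (idem_algebra f) p (f (0, 1)))) / sup_on ?V p"
    by (simp add: alg_eval_idem)
  also have "\<dots> \<le> spectral_const (f (0, 1)) (idem_algebra f)"
    unfolding spectral_const_def using pos by (intro Sup_upper) blast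
  also have "\<dots> \<le> Gamma2 TYPE('a)"
    unfolding Gamma2_def using unital_banach_algebra_idem_algebra idem_algebraic
    by (intro Sup_upper) force
  finally show ?thesis .
qed

end

text \<open>Taylor polynomials of the Blaschke factor \<open>(z - s) / (1 - s z)\<close>.\<close>

lemma exists_Blaschke_Taylor:
  "\<exists>p :: complex poly. \<forall>z. (1 - s * z) * poly p z = z - s - (1 - s\<^sup>2) * s ^ n * z ^ Suc n"
proof (induction n)
  case 0
  show ?case by (rule exI[of _ "[:- s:]"]) (simp add: power2_eq_square algebra_simps)
next
  case (Suc n)
  then obtain p :: "complex poly" where p: "\<And>z. (1 - s * z) * poly p z = z - s - (1 - s\<^sup>2) * s ^ n * z ^ Suc n"
    by blast
  show ?case
    by (rule exI[of _ "p + monom ((1 - s\<^sup>2) * s ^ n) (Suc n)"])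
      (simp add: p poly_monom distrib_left, simp add: algebra_simps)
qed

text \<open>The difference of the squared moduli factors as
  \<open>(1 - s\<^sup>2) * (1 - (cmod z)\<^sup>2)\<close>.\<close>

lemma cmod_Blaschke_le:
  fixes s :: real and z :: complex
  assumes "cmod z \<le> 1" "0 \<le> s" "s \<le> 1"
  shows "cmod (z - s) \<le> cmod (1 - s * z)"
proof (rule power2_le_imp_le)
  have "(cmod (1 - s * z))\<^sup>2 - (cmod (z - s))\<^sup>2 = (1 - s\<^sup>2) * (1 - (cmod z)\<^sup>2)"
    unfolding cmod_power2 by (simp add: power2_eq_square algebra_simps)
  moreover have "0 \<le> (1 - s\<^sup>2) * (1 - (cmod z)\<^sup>2)"
    using assms by (intro mult_nonneg_nonneg) (auto simp: power_le_one)
  ultimately show "(cmod (z - s))\<^sup>2 \<le> (cmod (1 - s * z))\<^sup>2" by linarith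
qed simp

text \<open>After division by \<open>1 - s * z\<close>, the Taylor remainder is at most
  \<open>(1 + s) * s ^ n\<close> on the unit disc, because \<open>cmod (1 - s * z)\<close> is at
  least \<open>1 - s\<close>; the Blaschke factor itself is bounded by 1.\<close>

lemma exists_almost_extremal_poly:
  fixes s :: real
  assumes s: "0 < s" "s < 1"
  obtains p :: "complex poly" where "poly p 0 = - s" "poly p 1 = 1 - (1 + s) * s ^ n"
    "\<And>z::complex. cmod z \<le> 1 \<Longrightarrow> cmod (poly p z) \<le> 1 + 2 * s ^ n"
proof -
  obtain p :: "complex poly" where p: "\<And>z::complex. (1 - s * z) * poly p z = z - s - (1 - s\<^sup>2) * s ^ n * z ^ Suc n"
    using exists_Blaschke_Taylor[of "of_real s" n] by auto
  show ?thesis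
  proof
    show "poly p 0 = - s" using p[of 0] by simp
    have "(1 - s) * poly p 1 = (1 - s) * (1 - (1 + s) * s ^ n)"
      using p[of 1] by (simp add: power2_eq_square algebra_simps)
    moreover have "1 - complex_of_real s \<noteq> 0" using s by simp
    ultimately show "poly p 1 = 1 - (1 + s) * s ^ n" by simp
    fix z :: complex assume z: "cmod z \<le> 1"
    have "s * cmod z \<le> s * 1" using z s by (intro mult_left_mono) auto
    then have "cmod (s * z) \<le> s" using s by (simp add: norm_mult)
    then have d: "1 - s \<le> cmod (1 - s * z)"
      using norm_triangle_ineq2[of 1 "s * z"] by simp
    have s2: "0 \<le> 1 - s\<^sup>2" using s by (simp add: power_le_one)
    have "cmod (1 - s * z) * cmod (poly p z) = cmod (z - s - (1 - s\<^sup>2) * s ^ n * z ^ Suc n)"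
      by (simp only: p flip: norm_mult)
    also have "\<dots> \<le> cmod (z - s) + cmod ((1 - s\<^sup>2) * s ^ n * z ^ Suc n)"
      by (rule norm_triangle_ineq4)
    also have "\<dots> \<le> cmod (1 - s * z) + (1 - s\<^sup>2) * s ^ n"
    proof (rule add_mono)
      show "cmod (z - s) \<le> cmod (1 - s * z)" using z s by (intro cmod_Blaschke_le) auto
      have "cmod ((1 - s\<^sup>2) * s ^ n * z ^ Suc n) = ((1 - s\<^sup>2) * s ^ n) * cmod z ^ Suc n"
        using s s2 by (simp add: norm_mult norm_power abs_mult del: of_real_mult of_real_power of_real_diff)
      also have "\<dots> \<le> ((1 - s\<^sup>2) * s ^ n) * 1"
        using s s2 z by (intro mult_left_mono) (auto simp: power_le_one simp del: power_Suc)
      finally show "cmod ((1 - s\<^sup>2) * s ^ n * z ^ Suc n) \<le> (1 - s\<^sup>2) * s ^ n" by simp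
    qed
    also have "(1 - s\<^sup>2) * s ^ n = (1 - s) * ((1 + s) * s ^ n)"
      by (simp add: power2_eq_square algebra_simps)
    also have "\<dots> \<le> cmod (1 - s * z) * (2 * s ^ n)"
      using d s by (intro mult_mono mult_right_mono) auto
    finally have "cmod (1 - s * z) * cmod (poly p z) \<le> cmod (1 - s * z) * (1 + 2 * s ^ n)"
      by (simp add: algebra_simps)
    moreover have "0 < cmod (1 - s * z)" using d s by linarith
    ultimately show "cmod (poly p z) \<le> 1 + 2 * s ^ n" by simp
  qed
qed

theorem Gamma2_ge_3:
  assumes "(UNIV :: complex set) \<lesssim> (UNIV :: 'a set)"
  shows "3 \<le> Gamma2 TYPE('a)"
proof -
  obtain g :: "complex \<Rightarrow> 'a" where g: "inj g" using assms by (auto simp: lepoll_def)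
  have "infinite (UNIV :: complex set)" by (simp add: infinite_UNIV_char_0)
  \<comment> \<open>Pairs of complex numbers are equinumerous with complex numbers, so the
    two-dimensional algebra fits into any type that contains a copy of
    \<open>complex\<close>.\<close>
  then obtain h :: "complex \<times> complex \<Rightarrow> complex" where "bij_betw h (UNIV \<times> UNIV) UNIV"
    using card_of_Times_same_infinite card_of_ordIso by blast
  then have f: "inj (g \<circ> h)" using g by (intro inj_compose) (auto simp: bij_betw_def)
  \<comment> \<open>As \<open>n\<close> grows, the numerator tends to \<open>s + (1 + s)\<close> and
    the bound on the disc to 1; only afterwards does \<open>s\<close> tend to 1.\<close>
  have step: "ereal (1 + 2 * s) \<le> Gamma2 TYPE('a)" if s: "0 < s" "s < 1" for s :: real
  proof (rule LIMSEQ_le_const2)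
    have "(\<lambda>n. ((1 + 2 * s) - 2 * s ^ n) / (1 + 2 * s ^ n)) \<longlonglongrightarrow> ((1 + 2 * s) - 2 * 0) / (1 + 2 * 0)"
      using s by (intro tendsto_intros LIMSEQ_power_zero) auto
    then show "(\<lambda>n. ereal (((1 + 2 * s) - 2 * s ^ n) / (1 + 2 * s ^ n))) \<longlonglongrightarrow> ereal (1 + 2 * s)"
      by simp
    have "ereal (((1 + 2 * s) - 2 * s ^ n) / (1 + 2 * s ^ n)) \<le> Gamma2 TYPE('a)" for n
    proof -
      obtain p :: "complex poly" where p: "poly p 0 = - s" "poly p 1 = 1 - (1 + s) * s ^ n"
        "\<And>z::complex. cmod z \<le> 1 \<Longrightarrow> cmod (poly p z) \<le> 1 + 2 * s ^ n"
        using exists_almost_extremal_poly[OF s] by blast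
      have "poly p 1 - poly p 0 = of_real ((1 + s) - (1 + s) * s ^ n)"
        unfolding p by simp
      then have "cmod (poly p 1 - poly p 0) \<ge> (1 + s) - (1 + s) * s ^ n"
        by (metis abs_ge_self norm_of_real)
      moreover have "(1 + s) * s ^ n \<le> 2 * s ^ n" using s by (intro mult_right_mono) auto
      moreover have "cmod (poly p 0) = s" using s p(1) by simp
      ultimately have "(1 + 2 * s) - 2 * s ^ n \<le> cmod (poly p 0) + cmod (poly p 1 - poly p 0)"
        by linarith
      then have "((1 + 2 * s) - 2 * s ^ n) / (1 + 2 * s ^ n)
          \<le> (cmod (poly p 0) + cmod (poly p 1 - poly p 0)) / (1 + 2 * s ^ n)"
        using s by (intro divide_right_mono) auto
      moreover have "poly p 0 \<noteq> 0" using p(1) s by simp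
      ultimately show ?thesis
        using Gamma2_ge[OF f, of p "1 + 2 * s ^ n"] p(3) by (meson ereal_less_eq(3) order.trans)
    qed
    then show "\<exists>N. \<forall>n\<ge>N. ereal (((1 + 2 * s) - 2 * s ^ n) / (1 + 2 * s ^ n)) \<le> Gamma2 TYPE('a)" by blast
  qed
  have "ereal 3 \<le> Gamma2 TYPE('a)"
  proof (rule LIMSEQ_le_const2)
    have "(\<lambda>n. 1 + 2 * (1 - 1 / real n)) \<longlonglongrightarrow> 1 + 2 * (1 - 0)"
      by (intro tendsto_intros lim_1_over_n)
    then show "(\<lambda>n. ereal (1 + 2 * (1 - 1 / real n))) \<longlonglongrightarrow> ereal 3" by simp
    \<comment> \<open>Starting at 2 keeps \<open>s = 1 - 1 / n\<close> strictly between 0 and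
      1.\<close>
    show "\<exists>N. \<forall>n\<ge>N. ereal (1 + 2 * (1 - 1 / real n)) \<le> Gamma2 TYPE('a)"
      by (intro exI[of _ 2] allI impI step) auto
  qed
  then show ?thesis by simp
qed

theorem theoremB:
  assumes "(UNIV :: complex set) \<lesssim> (UNIV :: 'a set)"
  shows "3 \<le> Gamma2 TYPE('a) \<and>
         Gamma2 TYPE('a) \<le> ereal (sqrt (1 + (2 * exp 1 - 1)\<^sup>2)) \<and>
         sqrt (1 + (2 * exp 1 - 1)\<^sup>2) < (4.55 :: real)"
proof (intro conjI)
  show "3 \<le> Gamma2 TYPE('a)" by (rule Gamma2_ge_3[OF assms])
  let ?C = "sqrt (1 + (2 * exp 1 - 1)\<^sup>2) :: real"
  show "Gamma2 TYPE('a) \<le> ereal ?C"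
    unfolding Gamma2_def
  proof (rule Sup_least, clarify)
    fix A :: "'a calgebra" and a
    assume "unital_banach_algebra A" and a: "a \<in> carrier A" "algebraic_elem A a" "algebraic_degree A a \<le> 2"
    then interpret unital_banach_algebra A by simp
    show "spectral_const a A \<le> ereal ?C"
      unfolding spectral_const_def
    proof (rule Sup_least, clarify)
      fix p assume pos: "0 < sup_on (numerical_range a A) p"
      show "ereal (nrm A (alg_eval A p a)) / sup_on (numerical_range a A) p \<le> ereal ?C"
      proof (cases "sup_on (numerical_range a A) p")
        case (real M)
        have "cmod (poly p z) \<le> M" if "z \<in> numerical_range a A" for z
        proof -
          have "ereal (cmod (poly p z)) \<le> sup_on (numerical_range a A) p"
            unfolding sup_on_def using that by (rule SUP_upper)
          then show ?thesis using real by simp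
        qed
        from nrm_alg_eval_le[OF a this] have "nrm A (alg_eval A p a) \<le> ?C * M" .
        moreover have "0 < M" using pos real by simp
        ultimately show ?thesis using real by (simp add: field_simps)
      \<comment> \<open>An infinite supremum makes the quotient 0, and positivity excludes the value
        minus infinity.\<close>
      qed (use pos in auto)
    qed
  qed
  \<comment> \<open>The constant 4.438 is \<open>2 * 2.719 - 1\<close>, from the upper bound for
    \<open>exp 1\<close>.\<close>
  have "(2 * exp 1 - 1)\<^sup>2 < (4438 / 1000 :: real)\<^sup>2"
    using exp_one_bounds by (intro power_strict_mono) auto
  then have "1 + (2 * exp 1 - 1)\<^sup>2 < (4.55 :: real)\<^sup>2" by (simp add: power2_eq_square)
  then show "?C < 4.55" by (intro real_less_lsqrt) auto
qed

end
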